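(* Let $T$ be a tree of order $n\ge4$ which is not isomorphic to the star $K_{1,n-1}$. Then $$\xi_2(T)+\xi_2(T^c)\ge\sqrt{\frac{13n-35-\sqrt{169n^2-974n+1417}}{2}}+\sqrt{\frac{4n+1-\sqrt{16n^2-56n+193}}{2}},$$ with equality if and only if $T\cong T_{n,3}^{0,n-4}$.
   Context: For a connected graph $G$, the eccentricity matrix $\mathcal{E}(G)$ is the matrix indexed by $V(G)$ whose $(u,v)$-entry is $d_G(u,v)$ if $d_G(u,v)=\min\{e_G(u),e_G(v)\}$ and $0$ otherwise, where $d_G$ is the graph distance and $e_G(u)=\max_v d_G(u,v)$. $\xi_2(G)$ denotes the second largest eigenvalue of $\mathcal{E}(G)$. $T^c$ is the complement of $T$. $T_{n,3}^{0,n-4}$ is the tree obtained from the path $v_0v_1v_2v_3$ by attaching $n-4$ pendant vertices to $v_2$. *)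

theory Defs
  imports "Graph_Theory.Graph_Theory" "Jordan_Normal_Form.Char_Poly"
begin

text \<open>
  A finite simple graph is a \<open>pair_graph\<close>: a finite, loopless, symmetric set of arcs,
  each edge \<open>uv\<close> being the two arcs \<open>(u,v)\<close> and \<open>(v,u)\<close>.
\<close>

text \<open>
  The predicate \<open>tree\<close> of \<open>Digraph_Component\<close> is meant for digraphs without antiparallel arcs:
  it counts \<open>u, v, u\<close> along an edge \<open>uv\<close> as a cycle. For a symmetric digraph the cycles
  of the undirected graph are the ones of length at least 3.
\<close>

definition undirected_tree :: "'a pair_pre_digraph \<Rightarrow> bool" where
  "undirected_tree G \<longleftrightarrow> pair_graph G \<and> Digraph_Component.connected (with_proj G) \<and>
     \<not> (\<exists>p. pre_digraph.cycle (with_proj G) p \<and> 3 \<le> length p)"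

definition graph_complement :: "'a pair_pre_digraph \<Rightarrow> 'a pair_pre_digraph" where
  "graph_complement G = \<lparr> pverts = pverts G,
     parcs = {(u, v). u \<in> pverts G \<and> v \<in> pverts G \<and> u \<noteq> v \<and> (u, v) \<notin> parcs G} \<rparr>"

text \<open>The following notions are only meant for nonempty connected graphs, where all distances are finite.\<close>

definition graph_dist :: "'a pair_pre_digraph \<Rightarrow> 'a \<Rightarrow> 'a \<Rightarrow> real" where
  "graph_dist G u v = real_of_ereal (wf_digraph.\<mu> (with_proj G) (\<lambda>_. 1) u v)"

definition eccentricity :: "'a pair_pre_digraph \<Rightarrow> 'a \<Rightarrow> real" where
  "eccentricity G u = Max (graph_dist G u ` pverts G)"

definition ecc_entry :: "'a pair_pre_digraph \<Rightarrow> 'a \<Rightarrow> 'a \<Rightarrow> real" where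
  "ecc_entry G u v =
     (if graph_dist G u v = min (eccentricity G u) (eccentricity G v) then graph_dist G u v else 0)"

text \<open>
  The library's matrices are indexed by natural numbers, so the vertices are enumerated by
  some list; another enumeration permutes rows and columns simultaneously and
  does not change the spectrum.
\<close>

definition vertex_list :: "'a pair_pre_digraph \<Rightarrow> 'a list" where
  "vertex_list G = (SOME vs. distinct vs \<and> set vs = pverts G)"

definition ecc_matrix :: "'a pair_pre_digraph \<Rightarrow> real mat" where
  "ecc_matrix G = mat (card (pverts G)) (card (pverts G))
     (\<lambda>(i, j). ecc_entry G (vertex_list G ! i) (vertex_list G ! j))"

text \<open>
  Eigenvalues listed in decreasing order, repeated according to their multiplicity as roots of
  the characteristic polynomial. As the eccentricity matrix is real symmetric, its real roots
  are all of them.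
\<close>

definition eigenvalues_desc :: "real mat \<Rightarrow> real list" where
  "eigenvalues_desc A = rev (sorted_list_of_multiset (proots (char_poly A)))"

definition ecc_eigenvalue :: "nat \<Rightarrow> 'a pair_pre_digraph \<Rightarrow> real" (\<open>\<xi>\<close>) where
  "\<xi> k G = eigenvalues_desc (ecc_matrix G) ! (k - 1)"

text \<open>
  \<open>T\<^sub>n\<^sub>,\<^sub>3\<close> with superscript \<open>0, n - 4\<close>: the path \<open>0, 1, 2, 3\<close> with the pendant vertices
  \<open>4, \<dots>, n - 1\<close> attached to the vertex \<open>2\<close>. Meant for \<open>n \<ge> 4\<close>.
  The superscript \<open>s\<close> is the symmetric closure \<open>symcl\<close>.
\<close>

definition path_pendant_tree :: "nat \<Rightarrow> nat pair_pre_digraph" where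
  "path_pendant_tree n = \<lparr> pverts = {0..<n},
     parcs = ({(0, 1), (1, 2), (2, 3)} \<union> {(2, i) | i. 4 \<le> i \<and> i < n})\<^sup>s \<rparr>"

end

theory Submission
  imports Defs "Jordan_Normal_Form.Schur_Decomposition" "Jordan_Normal_Form.Spectral_Radius"
begin

text \<open>
  For a tree of diameter 3, that is a double star with \<open>p\<close> and \<open>q\<close> leaves, the eccentricity
  matrices of \<open>T\<close> and of \<open>T\<^sup>c\<close> are both constant on a chain of four blocks of vertices.
  A positive eigenvalue \<open>\<mu>\<close> of such a matrix satisfies a quadratic equation in \<open>\<mu>\<^sup>2\<close>, which
  determines the two second largest eigenvalues in terms of \<open>n\<close> and \<open>pq\<close>. Both increase
  with \<open>pq\<close>, which is smallest, with value \<open>n - 3\<close>, exactly if \<open>p = 1\<close> or \<open>q = 1\<close>.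

  For a tree of diameter at least 4, two test functions supported on the first two and the last two
  vertices of a diametral path show that the second largest eigenvalues are at least \<open>8/5\<close> and \<open>2\<close>
  (the eccentricity matrix of \<open>T\<^sup>c\<close> is twice the adjacency matrix of \<open>T\<close>), whereas the two
  terms of the bound are smaller than these numbers.
\<close>

section \<open>Spectral theorem for real symmetric matrices\<close>

text \<open>Eigenvalues are counted with multiplicity as roots of a characteristic polynomial, so
  knowing which positive numbers are eigenvalues of a block matrix is not enough: their
  multiplicities matter too. The spectral theorem is therefore proved and restated for functions on
  the vertex set. On a chain of four blocks, an eigenfunction for a positive eigenvalue vanishes as
  soon as its sum over the second block does. So positive eigenvalues are simple, and the square of
  the second largest one is the smaller root of the quadratic equation. The structure of trees is
  derived from a single fact, that every edge is a bridge. It forces adjacent vertices onto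
  different distance levels from any root and makes parents unique. The growth with
  \<open>pq\<close> is not automatic for the tree itself, because the linear coefficient of its
  quadratic grows with \<open>pq\<close> as well. It hinges on the smaller root at
  \<open>pq = n - 3\<close> being below 16/9.\<close>

lemma real_symmetric_eigenvalue_exists:
  fixes A :: "real mat"
  assumes A: "A \<in> carrier_mat n n" and sym: "A\<^sup>T = A" and n: "n > 0"
  obtains k where "eigenvalue A k"
proof -
  define C where "C = map_mat complex_of_real A"
  have C: "C \<in> carrier_mat n n" using A by (simp add: C_def)
  obtain k where "eigenvalue C k"
    using spectrum_non_empty[OF C n] by (auto simp: spectrum_def)
  then obtain v where v: "v \<in> carrier_vec n" "v \<noteq> 0\<^sub>v n" "C *\<^sub>v v = k \<cdot>\<^sub>v v"
    using C by (auto simp: eigenvalue_def eigenvector_def)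
  have CT: "C\<^sup>T = C" using sym by (simp add: C_def map_mat_transpose)
  have conj: "conjugate (C *\<^sub>v v) = C *\<^sub>v conjugate v"
    using A v(1) by (intro eq_vecI) (auto simp: C_def scalar_prod_def intro!: sum.cong)
  \<comment> \<open>Moving the real symmetric matrix across the Hermitian product shows that
    \<open>k\<close> equals its own conjugate.\<close>
  have "k * (v \<bullet>c v) = (C *\<^sub>v v) \<bullet>c v"
    using v by simp
  also have "\<dots> = v \<bullet> (C *\<^sub>v conjugate v)"
    using transpose_vec_mult_scalar[OF C, of "conjugate v" v] v(1) CT by simp
  also have "\<dots> = v \<bullet>c (k \<cdot>\<^sub>v v)"
    using conj v(3) by simp
  also have "\<dots> = cnj k * (v \<bullet>c v)"
    using v(1) by (simp add: conjugate_smult_vec)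
  finally have "k = cnj k"
    using v by simp
  then obtain r where r: "k = complex_of_real r"
    by (metis Reals_cases Reals_cnj_iff)
  have "poly (char_poly C) k = complex_of_real (poly (char_poly A) r)"
    using of_real_hom.char_poly_hom[OF A, where ?'a = complex] r by (simp add: C_def)
  moreover have "poly (char_poly C) k = 0"
    using \<open>eigenvalue C k\<close> eigenvalue_root_char_poly[OF C] by simp
  ultimately have "eigenvalue A r"
    using eigenvalue_root_char_poly[OF A] by simp
  then show thesis by (rule that)
qed

text \<open>Gram-Schmidt applied to a basis starting with \<open>v\<close> yields an orthogonal
  family that still starts with \<open>v\<close>. Dividing by the norms makes it orthonormal, which
  is why the first column is only a multiple of \<open>v\<close>.\<close>

lemma orthogonal_completion:
  fixes v :: "real vec"
  assumes v: "v \<in> carrier_vec n" and v0: "v \<noteq> 0\<^sub>v n"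
  obtains U c where "U \<in> carrier_mat n n" "U\<^sup>T * U = 1\<^sub>m n" "U * U\<^sup>T = 1\<^sub>m n" "col U 0 = c \<cdot>\<^sub>v v"
proof -
  interpret cof_vec_space n "TYPE(real)" .
  have n: "n > 0" using v v0 by (cases n) auto
  define b where "b = basis_completion v"
  define ws where "ws = gram_schmidt n b"
  note bc = basis_completion[OF v v0, folded b_def]
  have ws: "set ws \<subseteq> carrier_vec n" "corthogonal ws" "length ws = n"
    using gram_schmidt_result[OF bc(2,4,5) refl, folded ws_def] bc(6) by auto
  obtain vs where "b = v # vs" using bc(6,7) n by (cases b) auto
  then have "hd ws = v" using gram_schmidt_hd[OF v, of vs] by (simp add: ws_def)
  then have ws0: "ws ! 0 = v" using n ws(3) by (cases ws) auto
  have wc: "ws ! i \<in> carrier_vec n" if "i < n" for i using ws that by auto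
  have orth: "ws ! i \<bullet> ws ! j = 0 \<longleftrightarrow> i \<noteq> j" if "i < n" "j < n" for i j
    using corthogonalD[OF ws(2), of i j] ws(3) that by simp
  have pos: "ws ! i \<bullet> ws ! i > 0" if "i < n" for i
    using orth[OF that that] conjugate_square_ge_0_vec[of "ws ! i"] by simp
  define s where "s i = 1 / sqrt (ws ! i \<bullet> ws ! i)" for i
  define U where "U = mat_of_cols n (map (\<lambda>i. s i \<cdot>\<^sub>v ws ! i) [0..<n])"
  have U: "U \<in> carrier_mat n n"
    using mat_of_cols_carrier(1)[of n "map (\<lambda>i. s i \<cdot>\<^sub>v ws ! i) [0..<n]"] unfolding U_def by simp
  have col: "col U i = s i \<cdot>\<^sub>v ws ! i" if "i < n" for i
    using that wc by (simp add: U_def)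
  have "U\<^sup>T * U = 1\<^sub>m n"
  proof (rule eq_matI)
    fix i j assume ij: "i < dim_row (1\<^sub>m n)" "j < dim_col (1\<^sub>m n)"
    then have "(U\<^sup>T * U) $$ (i, j) = s i * s j * (ws ! i \<bullet> ws ! j)"
      using U wc by (simp add: col smult_scalar_prod_distrib[of _ n] scalar_prod_smult_distrib[of _ n])
    also have "\<dots> = (if i = j then 1 else 0)"
      using ij orth pos[of i] by (auto simp: s_def)
    finally show "(U\<^sup>T * U) $$ (i, j) = 1\<^sub>m n $$ (i, j)" using ij by simp
  qed (use U in auto)
  moreover from this have "U * U\<^sup>T = 1\<^sub>m n"
    using mat_mult_left_right_inverse U by (metis transpose_carrier_mat)
  ultimately show thesis
    using that[of U "s 0"] U col[OF n] ws0 by simp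
qed

lemma char_poly_orthogonal_diag:
  fixes A :: "real mat"
  assumes U: "U \<in> carrier_mat n n" "U * U\<^sup>T = 1\<^sub>m n" "U\<^sup>T * U = 1\<^sub>m n" and len: "length es = n"
    and A: "A = U * mat_diag n (\<lambda>i. es ! i) * U\<^sup>T"
  shows "char_poly A = (\<Prod>e\<leftarrow>es. [:-e, 1:])"
proof -
  define D where "D = mat_diag n (\<lambda>i. es ! i)"
  have "similar_mat A D"
    by (rule similar_matI[of _ _ U "U\<^sup>T" n]) (use U A in \<open>auto simp: D_def\<close>)
  moreover have "diag_mat D = es"
    using len by (auto simp: D_def diag_mat_def mat_diag_def intro!: nth_equalityI)
  moreover have "char_poly D = (\<Prod>e\<leftarrow>diag_mat D. [:-e, 1:])"
    by (rule char_poly_upper_triangular[of D n]) (auto simp: D_def mat_diag_def upper_triangular_def)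
  ultimately show ?thesis using char_poly_similar by metis
qed

lemma root_prod_list_linear_iff:
  "poly (\<Prod>e\<leftarrow>es. [:-e, 1:]) (x :: 'a :: idom) = 0 \<longleftrightarrow> x \<in> set es"
  by (induction es) auto

text \<open>Deflation: each step splits off the largest eigenvalue, so that the diagonal comes out
  in decreasing order. In an orthonormal basis starting with its eigenvector, symmetry clears the
  first row along with the first column, and the remaining block is again symmetric.\<close>

lemma real_symmetric_spectral:
  fixes A :: "real mat"
  assumes "A \<in> carrier_mat n n" "A\<^sup>T = A"
  shows "\<exists>U es. U \<in> carrier_mat n n \<and> U * U\<^sup>T = 1\<^sub>m n \<and> U\<^sup>T * U = 1\<^sub>m n \<and> length es = n \<and>
    sorted_wrt (\<ge>) es \<and> A = U * mat_diag n (\<lambda>i. es ! i) * U\<^sup>T"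
  using assms
proof (induction n arbitrary: A)
  case 0
  show ?case by (rule exI[of _ "1\<^sub>m 0"], rule exI[of _ "[]"]) (use 0 in auto)
next
  case (Suc m)
  note A = Suc.prems(1) and sym = Suc.prems(2)
  have fin: "finite {k. eigenvalue A k}"
    using eigenvalue_root_char_poly[OF A] poly_roots_finite[of "char_poly A"]
      degree_monic_char_poly[OF A] by (cases "char_poly A = 0") auto
  define e where "e = Max {k. eigenvalue A k}"
  have "{k. eigenvalue A k} \<noteq> {}"
    using real_symmetric_eigenvalue_exists[OF A sym] by auto
  then have e: "eigenvalue A e"
    using Max_in[OF fin] by (simp add: e_def)
  have emax: "k \<le> e" if "eigenvalue A k" for k
    using Max_ge[OF fin] that by (simp add: e_def)
  obtain v where v: "v \<in> carrier_vec (Suc m)" "v \<noteq> 0\<^sub>v (Suc m)" "A *\<^sub>v v = e \<cdot>\<^sub>v v"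
    using e A by (auto simp: eigenvalue_def eigenvector_def)
  obtain W c where W: "W \<in> carrier_mat (Suc m) (Suc m)" "W\<^sup>T * W = 1\<^sub>m (Suc m)"
    "W * W\<^sup>T = 1\<^sub>m (Suc m)" and col: "col W 0 = c \<cdot>\<^sub>v v"
    using orthogonal_completion[OF v(1,2)] by metis
  define B where "B = W\<^sup>T * A * W"
  have B: "B \<in> carrier_mat (Suc m) (Suc m)" using A W by (simp add: B_def)
  note assoc = assoc_mult_mat[of _ "Suc m" "Suc m" _ "Suc m" _ "Suc m"]
  have symB: "B\<^sup>T = B"
  proof -
    have "B\<^sup>T = W\<^sup>T * (W\<^sup>T * A)\<^sup>T"
      unfolding B_def by (rule transpose_mult) (use A W in auto)
    also have "(W\<^sup>T * A)\<^sup>T = A * W"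
      using transpose_mult[of "W\<^sup>T" "Suc m" "Suc m" A "Suc m"] A W sym by simp
    finally show ?thesis using A W(1) by (simp add: B_def assoc)
  qed
  have AB: "A = W * B * W\<^sup>T"
  proof -
    have "W * B * W\<^sup>T = (W * W\<^sup>T) * A * (W * W\<^sup>T)"
      using A W(1) by (simp add: B_def assoc)
    then show ?thesis using A W(3) by simp
  qed
  have B0: "B $$ (i, 0) = (if i = 0 then e else 0)" if i: "i < Suc m" for i
  proof -
    have "B $$ (i, 0) = (W\<^sup>T * (A * W)) $$ (i, 0)"
      using A W(1) by (simp add: B_def assoc)
    also have "\<dots> = col W i \<bullet> (A *\<^sub>v col W 0)"
      using A W(1) i by (simp add: mult_mat_vec_def)
    also have "A *\<^sub>v col W 0 = e \<cdot>\<^sub>v col W 0"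
      using A v by (simp add: col mult_mat_vec[of _ "Suc m" "Suc m"] smult_smult_assoc mult.commute)
    also have "col W i \<bullet> (e \<cdot>\<^sub>v col W 0) = e * (W\<^sup>T * W) $$ (i, 0)"
      using W(1) i by simp
    finally show ?thesis using W(2) i by simp
  qed
  define C where "C = mat m m (\<lambda>(i, j). B $$ (Suc i, Suc j))"
  have C: "C \<in> carrier_mat m m" by (simp add: C_def)
  have Bsym: "B $$ (i, j) = B $$ (j, i)" if "i < Suc m" "j < Suc m" for i j
    using arg_cong[OF symB, of "\<lambda>M. M $$ (i, j)"] B that by simp
  have symC: "C\<^sup>T = C" using Bsym by (intro eq_matI) (auto simp: C_def)
  define E where "E = mat 1 1 (\<lambda>_. e)"
  have E: "E \<in> carrier_mat 1 1" by (simp add: E_def)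
  have BC: "B = four_block_mat E (0\<^sub>m 1 m) (0\<^sub>m m 1) C"
    using B B0 Bsym[of 0] by (intro eq_matI) (auto simp: E_def C_def split: nat.splits)
  obtain V es where V: "V \<in> carrier_mat m m" "V * V\<^sup>T = 1\<^sub>m m" "V\<^sup>T * V = 1\<^sub>m m" and
    es: "length es = m" "sorted_wrt (\<ge>) es" and CV: "C = V * mat_diag m (\<lambda>i. es ! i) * V\<^sup>T"
    using Suc.IH[OF C symC] by metis
  define F where "F = four_block_mat (1\<^sub>m 1) (0\<^sub>m 1 m) (0\<^sub>m m 1) V"
  have F: "F \<in> carrier_mat (Suc m) (Suc m)" using four_block_carrier_mat[of "1\<^sub>m 1" 1 1 V m m] V(1) by (simp add: F_def)
  have FT: "F\<^sup>T = four_block_mat (1\<^sub>m 1) (0\<^sub>m 1 m) (0\<^sub>m m 1) (V\<^sup>T)"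
    unfolding F_def by (subst transpose_four_block_mat[of _ 1 1 _ m _ m]) (use V(1) in auto)
  have F1: "F * F\<^sup>T = 1\<^sub>m (Suc m)"
    unfolding FT unfolding F_def
    by (subst mult_four_block_mat[of _ 1 1 _ m _ m _ _ 1 _ m]) (use V in \<open>auto simp: four_block_one_mat\<close>)
  define D where "D = mat_diag (Suc m) (\<lambda>i. (e # es) ! i)"
  have D: "D = four_block_mat E (0\<^sub>m 1 m) (0\<^sub>m m 1) (mat_diag m (\<lambda>i. es ! i))"
    by (intro eq_matI) (auto simp: D_def E_def mat_diag_def nth_Cons split: nat.splits)
  have Dc: "D \<in> carrier_mat (Suc m) (Suc m)" by (simp add: D_def)
  define G where "G = mat_diag m (\<lambda>i. es ! i)"
  have G: "G \<in> carrier_mat m m" by (simp add: G_def)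
  have VG: "V * G \<in> carrier_mat m m" "V * G * V\<^sup>T \<in> carrier_mat m m" using V(1) G by auto
  have FD: "F * D = four_block_mat E (0\<^sub>m 1 m) (0\<^sub>m m 1) (V * G)"
    unfolding D F_def G_def[symmetric] by (subst mult_four_block_mat[of _ 1 1 _ m _ m _ _ 1 _ m]) (use V E G in \<open>auto simp del: One_nat_def\<close>)
  have BF: "B = F * D * F\<^sup>T"
    unfolding FD FT BC CV G_def[symmetric]
    by (subst mult_four_block_mat[of _ 1 1 _ m _ m _ _ 1 _ m]) (use V E VG in \<open>auto simp del: One_nat_def\<close>)
  define U where "U = W * F"
  have U: "U \<in> carrier_mat (Suc m) (Suc m)" using W(1) F by (simp add: U_def)
  have UT: "U\<^sup>T = F\<^sup>T * W\<^sup>T" unfolding U_def by (rule transpose_mult[OF W(1) F])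
  have "U * U\<^sup>T = W * (F * F\<^sup>T) * W\<^sup>T"
    unfolding UT unfolding U_def using W(1) F by (simp add: assoc)
  then have U1: "U * U\<^sup>T = 1\<^sub>m (Suc m)" using F1 W by simp
  then have U2: "U\<^sup>T * U = 1\<^sub>m (Suc m)"
    using mat_mult_left_right_inverse U by (metis transpose_carrier_mat)
  have AU: "A = U * D * U\<^sup>T"
    unfolding UT unfolding U_def AB BF using W(1) F Dc
    by (simp add: assoc)
  have cpA: "char_poly A = (\<Prod>k\<leftarrow>e # es. [:-k, 1:])"
    by (rule char_poly_orthogonal_diag[OF U U1 U2]) (use es AU in \<open>auto simp: D_def\<close>)
  \<comment> \<open>The eigenvalues of the smaller block are roots of the characteristic polynomial
    of \<open>A\<close>, so the maximality of \<open>e\<close> allows it to head the sorted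
    list.\<close>
  have "k \<le> e" if "k \<in> set es" for k
    using emax[of k] eigenvalue_root_char_poly[OF A, of k] that
    unfolding cpA root_prod_list_linear_iff by simp
  then have "sorted_wrt (\<ge>) (e # es)" using es(2) by simp
  then show ?case
    using U U1 U2 AU es(1) unfolding D_def by (intro exI[of _ U] exI[of _ "e # es"]) simp
qed

lemma eigenvalues_desc_eqI:
  assumes "char_poly A = (\<Prod>e\<leftarrow>es. [:-e, 1:])" "sorted_wrt (\<ge>) es"
  shows "eigenvalues_desc A = es"
proof -
  have "proots (\<Prod>e\<leftarrow>es. [:-e, 1:]) = mset es"
  proof (induction es)
    case (Cons a es)
    have "(\<Prod>e\<leftarrow>es. [:-e, 1:]) \<noteq> 0"
      by (auto simp: prod_list_zero_iff)
    then show ?case using Cons.IH proots_mult[of "[:-a, 1:]" "\<Prod>e\<leftarrow>es. [:-e, 1:]"]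
      by (simp del: mult_pCons_left)
  qed simp
  moreover have "sorted (rev es)"
    using assms(2) by (simp add: sorted_wrt_rev)
  then have "sort es = rev es"
    by (metis mset_rev properties_for_sort)
  ultimately show ?thesis
    using assms(1) by (simp add: eigenvalues_desc_def)
qed

text \<open>Removes the enumeration \<open>vs\<close>: from here on eigenvectors are functions on
  \<open>V\<close>. Orthonormality is read off from \<open>U\<^sup>T * U = 1\<close>, completeness
  from \<open>U * U\<^sup>T = 1\<close>; completeness is what permits expanding arbitrary
  functions.\<close>

lemma real_symmetric_eigenbasis:
  fixes M :: "'a \<Rightarrow> 'a \<Rightarrow> real"
  assumes vs: "distinct vs" "set vs = V"
    and sym: "\<And>x y. x \<in> V \<Longrightarrow> y \<in> V \<Longrightarrow> M x y = M y x"
  defines "n \<equiv> card V"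
  defines "es \<equiv> eigenvalues_desc (mat n n (\<lambda>(i, j). M (vs ! i) (vs ! j)))"
  shows "length es = n" "sorted_wrt (\<ge>) es"
    "\<exists>u. (\<forall>k<n. \<forall>x\<in>V. (\<Sum>y\<in>V. M x y * u k y) = es ! k * u k x) \<and>
         (\<forall>j<n. \<forall>k<n. (\<Sum>x\<in>V. u j x * u k x) = (if j = k then 1 else 0)) \<and>
         (\<forall>x\<in>V. \<forall>y\<in>V. (\<Sum>k<n. u k x * u k y) = (if x = y then 1 else 0))"
proof -
  have n: "length vs = n" using vs by (metis distinct_card n_def)
  define A where "A = mat n n (\<lambda>(i, j). M (vs ! i) (vs ! j))"
  have A: "A \<in> carrier_mat n n" by (simp add: A_def)
  have inV: "vs ! i \<in> V" if "i < n" for i using that n vs(2) by auto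
  have "A\<^sup>T = A"
    by (rule eq_matI) (use sym[OF inV inV] in \<open>auto simp: A_def\<close>)
  from real_symmetric_spectral[OF A this] obtain U ds where
    U: "U \<in> carrier_mat n n" "U * U\<^sup>T = 1\<^sub>m n" "U\<^sup>T * U = 1\<^sub>m n" and
    ds: "length ds = n" "sorted_wrt (\<ge>) ds" and AU: "A = U * mat_diag n (\<lambda>i. ds ! i) * U\<^sup>T"
    by metis
  have "es = ds"
    unfolding es_def A_def[symmetric]
    by (rule eigenvalues_desc_eqI[OF char_poly_orthogonal_diag[OF U ds(1) AU] ds(2)])
  with ds show "length es = n" "sorted_wrt (\<ge>) es" by auto
  have "A * U = U * mat_diag n (\<lambda>i. ds ! i) * (U\<^sup>T * U)"
    unfolding AU using U(1) assoc_mult_mat[of "U * mat_diag n (\<lambda>i. ds ! i)" n n "U\<^sup>T" n U n]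
    by simp
  then have AU': "A * U = mat n n (\<lambda>(i, j). U $$ (i, j) * ds ! j)"
    using U mat_diag_mult_right[OF U(1), of "\<lambda>i. ds ! i"] by simp
  have bij: "bij_betw ((!) vs) {..<n} V"
    using bij_betw_nth[OF vs(1) _ vs(2)[symmetric], of "{..<n}"] n by simp
  define ix where "ix = the_inv_into {..<n} ((!) vs)"
  have ix: "ix (vs ! i) = i" if "i < n" for i
    using bij that unfolding ix_def by (intro the_inv_into_f_f) (auto simp: bij_betw_def)
  have ixV: "\<exists>i<n. x = vs ! i \<and> ix x = i" if "x \<in> V" for x
    using that bij ix by (auto simp: bij_betw_def)
  have sumV: "(\<Sum>x\<in>V. g x) = (\<Sum>i<n. g (vs ! i))" for g :: "'a \<Rightarrow> real"
    using sum.reindex_bij_betw[OF bij, of g] by simp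
  define u where "u k x = U $$ (ix x, k)" for k x
  have "(\<Sum>y\<in>V. M x y * u k y) = es ! k * u k x" if k: "k < n" and x: "x \<in> V" for k x
  proof -
    obtain i where i: "i < n" "x = vs ! i" "ix x = i" using ixV[OF x] by blast
    have "(\<Sum>y\<in>V. M x y * u k y) = (\<Sum>j<n. A $$ (i, j) * U $$ (j, k))"
      unfolding sumV using i by (intro sum.cong) (auto simp: u_def ix A_def)
    also have "\<dots> = (A * U) $$ (i, k)"
      using A U(1) i k by (auto simp: scalar_prod_def atLeast0LessThan intro!: sum.cong)
    finally show ?thesis using i k \<open>es = ds\<close> by (simp add: AU' u_def)
  qed
  moreover have "(\<Sum>x\<in>V. u j x * u k x) = (if j = k then 1 else 0)" if "j < n" "k < n" for j k
  proof -
    have "(\<Sum>x\<in>V. u j x * u k x) = (U\<^sup>T * U) $$ (j, k)"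
      unfolding sumV using U(1) that
      by (auto simp: scalar_prod_def atLeast0LessThan u_def ix intro!: sum.cong)
    then show ?thesis using U that by simp
  qed
  moreover have "(\<Sum>k<n. u k x * u k y) = (if x = y then 1 else 0)" if xy: "x \<in> V" "y \<in> V" for x y
  proof -
    obtain i j where ij: "i < n" "x = vs ! i" "ix x = i" "j < n" "y = vs ! j" "ix y = j"
      using ixV[OF xy(1)] ixV[OF xy(2)] by blast
    have "(\<Sum>k<n. u k x * u k y) = (U * U\<^sup>T) $$ (i, j)"
      using U(1) ij by (auto simp: scalar_prod_def atLeast0LessThan u_def intro!: sum.cong)
    then show ?thesis using U ij nth_eq_iff_index_eq[OF vs(1)] n by simp
  qed
  ultimately show "\<exists>u. (\<forall>k<n. \<forall>x\<in>V. (\<Sum>y\<in>V. M x y * u k y) = es ! k * u k x) \<and>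
         (\<forall>j<n. \<forall>k<n. (\<Sum>x\<in>V. u j x * u k x) = (if j = k then 1 else 0)) \<and>
         (\<forall>x\<in>V. \<forall>y\<in>V. (\<Sum>k<n. u k x * u k y) = (if x = y then 1 else 0))"
    by (intro exI[of _ u] conjI allI ballI impI) blast+
qed

section \<open>Rayleigh quotients and a lower bound for the second eigenvalue\<close>

definition bilin :: "'a set \<Rightarrow> ('a \<Rightarrow> 'a \<Rightarrow> real) \<Rightarrow> ('a \<Rightarrow> real) \<Rightarrow> ('a \<Rightarrow> real) \<Rightarrow> real" where
  "bilin V M f g = (\<Sum>x\<in>V. f x * (\<Sum>y\<in>V. M x y * g y))"

lemma bilin_lin_comb:
  "bilin V M (\<lambda>x. a * f x + b * g x) (\<lambda>x. a * f x + b * g x) =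
    a * a * bilin V M f f + a * b * (bilin V M f g + bilin V M g f) + b * b * bilin V M g g"
proof -
  have "(\<Sum>y\<in>V. M x y * (a * f y + b * g y)) = a * (\<Sum>y\<in>V. M x y * f y) + b * (\<Sum>y\<in>V. M x y * g y)" for x
    by (simp add: sum_distrib_left sum.distrib algebra_simps)
  then show ?thesis
    by (simp add: bilin_def sum_distrib_left sum.distrib algebra_simps)
qed

lemma bilin_sym:
  assumes "\<And>x y. x \<in> V \<Longrightarrow> y \<in> V \<Longrightarrow> M x y = M y x"
  shows "bilin V M f g = bilin V M g f"
proof -
  have eq: "f x * M x y * g y = g y * M y x * f x" if "x \<in> V" "y \<in> V" for x y
    using assms[OF that] by simp
  have "bilin V M f g = (\<Sum>x\<in>V. \<Sum>y\<in>V. f x * M x y * g y)"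
    by (simp add: bilin_def sum_distrib_left mult.assoc)
  also have "\<dots> = (\<Sum>y\<in>V. \<Sum>x\<in>V. g y * M y x * f x)"
    using eq by (subst sum.swap) (intro sum.cong refl)
  also have "\<dots> = bilin V M g f"
    by (simp add: bilin_def sum_distrib_left mult.assoc)
  finally show ?thesis .
qed

text \<open>Some combination \<open>h\<close> of \<open>f\<close> and \<open>g\<close> is orthogonal to the first eigenvector.\<close>

lemma second_eigenvalue_ge:
  fixes M :: "'a \<Rightarrow> 'a \<Rightarrow> real"
  assumes vs: "distinct vs" "set vs = V"
    and sym: "\<And>x y. x \<in> V \<Longrightarrow> y \<in> V \<Longrightarrow> M x y = M y x"
    and card: "2 \<le> card V"
    and orth: "(\<Sum>x\<in>V. f x * g x) = 0" "bilin V M f g = 0"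
    and f: "(\<Sum>x\<in>V. f x * f x) > 0" "c * (\<Sum>x\<in>V. f x * f x) \<le> bilin V M f f"
    and g: "(\<Sum>x\<in>V. g x * g x) > 0" "c * (\<Sum>x\<in>V. g x * g x) \<le> bilin V M g g"
  shows "c \<le> eigenvalues_desc (mat (card V) (card V) (\<lambda>(i, j). M (vs ! i) (vs ! j))) ! 1"
proof -
  define es where "es = eigenvalues_desc (mat (card V) (card V) (\<lambda>(i, j). M (vs ! i) (vs ! j)))"
  define n where "n = card V"
  have sp: "length es = n" "sorted_wrt (\<ge>) es"
    unfolding es_def n_def by (rule real_symmetric_eigenbasis[OF vs]; rule sym; assumption)+
  have "\<exists>u. (\<forall>k<n. \<forall>x\<in>V. (\<Sum>y\<in>V. M x y * u k y) = es ! k * u k x) \<and>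
         (\<forall>j<n. \<forall>k<n. (\<Sum>x\<in>V. u j x * u k x) = (if j = k then 1 else 0)) \<and>
         (\<forall>x\<in>V. \<forall>y\<in>V. (\<Sum>k<n. u k x * u k y) = (if x = y then 1 else 0))"
    unfolding es_def n_def by (rule real_symmetric_eigenbasis(3)[OF vs]) (rule sym)
  then obtain u where u': "\<forall>k<n. \<forall>x\<in>V. (\<Sum>y\<in>V. M x y * u k y) = es ! k * u k x"
    "\<forall>x\<in>V. \<forall>y\<in>V. (\<Sum>k<n. u k x * u k y) = (if x = y then 1 else 0)"
    by (elim exE conjE)
  have u: "(\<Sum>y\<in>V. M x y * u k y) = es ! k * u k x" if "k < n" "x \<in> V" for k x
    using u'(1) that by blast
  have uu: "(\<Sum>k<n. u k x * u k y) = (if x = y then 1 else 0)" if "x \<in> V" "y \<in> V" for x y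
    using u'(2) that by blast
  have finV: "finite V" using vs(2) by auto
  \<comment> \<open>Coordinates in the eigenbasis; the norm and the quadratic form become sums of
    their squares, the latter weighted by the eigenvalues.\<close>
  define co where "co h k = (\<Sum>x\<in>V. u k x * h x)" for h :: "'a \<Rightarrow> real" and k
  have expand: "h x = (\<Sum>k<n. co h k * u k x)" if x: "x \<in> V" for h x
  proof -
    have "(\<Sum>k<n. co h k * u k x) = (\<Sum>y\<in>V. h y * (\<Sum>k<n. u k y * u k x))"
      unfolding co_def sum_distrib_right sum_distrib_left
      by (subst sum.swap) (simp add: mult_ac)
    also have "\<dots> = (\<Sum>y\<in>V. if y = x then h y else 0)"
      by (rule sum.cong) (use uu x in auto)
    finally show ?thesis using x finV by simp
  qed
  have parseval: "(\<Sum>x\<in>V. h x * h x) = (\<Sum>k<n. (co h k)\<^sup>2)" for h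
  proof -
    have "(\<Sum>x\<in>V. h x * h x) = (\<Sum>x\<in>V. h x * (\<Sum>k<n. co h k * u k x))"
      using expand by (intro sum.cong) auto
    also have "\<dots> = (\<Sum>k<n. co h k * (\<Sum>x\<in>V. u k x * h x))"
      unfolding sum_distrib_left by (subst sum.swap) (simp add: mult_ac)
    finally show ?thesis by (simp add: co_def power2_eq_square)
  qed
  have quad: "bilin V M h h = (\<Sum>k<n. es ! k * (co h k)\<^sup>2)" for h
  proof -
    have Mh: "(\<Sum>y\<in>V. M x y * h y) = (\<Sum>k<n. co h k * (es ! k * u k x))" if x: "x \<in> V" for x
    proof -
      have "(\<Sum>y\<in>V. M x y * h y) = (\<Sum>y\<in>V. \<Sum>k<n. co h k * (M x y * u k y))"
      proof (rule sum.cong[OF refl])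
        fix y assume "y \<in> V"
        then have "M x y * h y = M x y * (\<Sum>k<n. co h k * u k y)" using expand by metis
        then show "M x y * h y = (\<Sum>k<n. co h k * (M x y * u k y))"
          by (simp add: sum_distrib_left mult.left_commute)
      qed
      also have "\<dots> = (\<Sum>k<n. \<Sum>y\<in>V. co h k * (M x y * u k y))"
        by (rule sum.swap)
      also have "\<dots> = (\<Sum>k<n. co h k * (\<Sum>y\<in>V. M x y * u k y))"
        by (simp only: sum_distrib_left)
      also have "\<dots> = (\<Sum>k<n. co h k * (es ! k * u k x))"
        by (rule sum.cong[OF refl]) (use u x in auto)
      finally show ?thesis .
    qed
    have "bilin V M h h = (\<Sum>x\<in>V. h x * (\<Sum>k<n. co h k * (es ! k * u k x)))"
      unfolding bilin_def by (rule sum.cong[OF refl]) (simp only: Mh)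
    also have "\<dots> = (\<Sum>k<n. es ! k * co h k * (\<Sum>x\<in>V. u k x * h x))"
      unfolding sum_distrib_left by (subst sum.swap) (simp add: mult_ac)
    finally show ?thesis by (simp add: co_def power2_eq_square mult_ac)
  qed
  \<comment> \<open>Without a component along the first eigenvector, the Rayleigh quotient of
    \<open>h\<close> is at most the second eigenvalue.\<close>
  have main: "c \<le> es ! 1" if h0: "co h 0 = 0" and hp: "(\<Sum>x\<in>V. h x * h x) > 0"
    and hq: "c * (\<Sum>x\<in>V. h x * h x) \<le> bilin V M h h" for h
  proof -
    have "es ! k * (co h k)\<^sup>2 \<le> es ! 1 * (co h k)\<^sup>2" if "k < n" for k
    proof (cases "k \<le> 1")
      case True
      then have "k = 0 \<or> k = 1" by auto
      then show ?thesis using h0 by auto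
    next
      case False
      then have "es ! k \<le> es ! 1"
        using sp(1,2) that by (intro sorted_wrt_nth_less[of "(\<ge>)"]) auto
      then show ?thesis by (simp add: mult_right_mono)
    qed
    then have "(\<Sum>k<n. es ! k * (co h k)\<^sup>2) \<le> (\<Sum>k<n. es ! 1 * (co h k)\<^sup>2)"
      by (intro sum_mono) auto
    then have "bilin V M h h \<le> es ! 1 * (\<Sum>x\<in>V. h x * h x)"
      by (simp add: quad parseval sum_distrib_left)
    with hq have "c * (\<Sum>x\<in>V. h x * h x) \<le> es ! 1 * (\<Sum>x\<in>V. h x * h x)" by linarith
    then show ?thesis using hp by simp
  qed
  have "c \<le> es ! 1"
  proof (cases "co f 0 = 0")
    case True
    then show ?thesis using main f by blast
  next
    case False
    \<comment> \<open>Chosen so that the components of \<open>a * f\<close> and \<open>b * g\<close>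
      along the first eigenvector cancel. The two orthogonality assumptions remove the cross terms,
      so the bounds for \<open>f\<close> and \<open>g\<close> simply add up.\<close>
    define a b where "a = co g 0" and "b = - co f 0"
    define h where "h x = a * f x + b * g x" for x
    have b: "b * b > 0" using False by (auto simp: b_def zero_less_mult_iff neq_iff)
    have N: "(\<Sum>x\<in>V. h x * h x) = a * a * (\<Sum>x\<in>V. f x * f x) + b * b * (\<Sum>x\<in>V. g x * g x)"
    proof -
      have "(\<Sum>x\<in>V. h x * h x) = a * a * (\<Sum>x\<in>V. f x * f x) + 2 * (a * b) * (\<Sum>x\<in>V. f x * g x)
        + b * b * (\<Sum>x\<in>V. g x * g x)"
        by (simp add: h_def sum_distrib_left sum.distrib algebra_simps)
      then show ?thesis using orth by simp
    qed
    have Q: "bilin V M h h = a * a * bilin V M f f + b * b * bilin V M g g"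
    proof -
      have "bilin V M f g = bilin V M g f" by (rule bilin_sym) (rule sym)
      then show ?thesis unfolding h_def bilin_lin_comb using orth by simp
    qed
    show ?thesis
    proof (rule main[of h])
      have "co h 0 = a * co f 0 + b * co g 0"
        by (simp add: co_def h_def sum_distrib_left sum.distrib algebra_simps)
      then show "co h 0 = 0" by (simp add: a_def b_def)
      show "(\<Sum>x\<in>V. h x * h x) > 0"
        unfolding N using f(1) mult_pos_pos[OF b g(1)] by (intro add_nonneg_pos mult_nonneg_nonneg[OF zero_le_square]) auto
      have "a * a * (c * (\<Sum>x\<in>V. f x * f x)) + b * b * (c * (\<Sum>x\<in>V. g x * g x))
        \<le> a * a * bilin V M f f + b * b * bilin V M g g"
        using f g by (intro add_mono mult_left_mono zero_le_square) auto
      then show "c * (\<Sum>x\<in>V. h x * h x) \<le> bilin V M h h"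
        unfolding N Q by (simp add: algebra_simps)
    qed
  qed
  then show ?thesis by (simp add: es_def)
qed

section \<open>Kernels that are constant on a chain of four blocks\<close>

text \<open>A weighted path \<open>A - B - C - D\<close> of blocks with weights 2, 3, 2. These are
  the distances that survive in the eccentricity matrices of a double star and of its
  complement.\<close>

definition chain_kernel :: "'a set \<Rightarrow> 'a set \<Rightarrow> 'a set \<Rightarrow> 'a set \<Rightarrow> 'a \<Rightarrow> 'a \<Rightarrow> real" where
  "chain_kernel A B C D x y =
    (if x \<in> A \<and> y \<in> B \<or> x \<in> B \<and> y \<in> A \<or> x \<in> C \<and> y \<in> D \<or> x \<in> D \<and> y \<in> C then 2
     else if x \<in> B \<and> y \<in> C \<or> x \<in> C \<and> y \<in> B then 3 else 0)"

lemma chain_kernel_sym: "chain_kernel A B C D x y = chain_kernel A B C D y x"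
  unfolding chain_kernel_def
  by (rule if_cong, blast, rule refl, rule if_cong, blast, rule refl, rule refl)

locale block_chain =
  fixes A B C D V :: "'a set" and M :: "'a \<Rightarrow> 'a \<Rightarrow> real"
  assumes V: "V = A \<union> B \<union> C \<union> D"
    and fin: "finite V"
    and nonempty: "A \<noteq> {}" "B \<noteq> {}" "C \<noteq> {}" "D \<noteq> {}"
    and disj: "A \<inter> B = {}" "A \<inter> C = {}" "A \<inter> D = {}" "B \<inter> C = {}" "B \<inter> D = {}" "C \<inter> D = {}"
    and M: "\<And>x y. x \<in> V \<Longrightarrow> y \<in> V \<Longrightarrow> M x y = chain_kernel A B C D x y"
begin

lemma blocks_disjoint:
  "x \<in> A \<Longrightarrow> x \<notin> B \<and> x \<notin> C \<and> x \<notin> D"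
  "x \<in> B \<Longrightarrow> x \<notin> A \<and> x \<notin> C \<and> x \<notin> D"
  "x \<in> C \<Longrightarrow> x \<notin> A \<and> x \<notin> B \<and> x \<notin> D"
  "x \<in> D \<Longrightarrow> x \<notin> A \<and> x \<notin> B \<and> x \<notin> C"
  using disj by blast+

lemma in_V: "x \<in> V \<longleftrightarrow> x \<in> A \<or> x \<in> B \<or> x \<in> C \<or> x \<in> D"
  by (simp add: V)

lemma finite_blocks: "finite A" "finite B" "finite C" "finite D"
  using fin V by auto

lemma M_sym: "x \<in> V \<Longrightarrow> y \<in> V \<Longrightarrow> M x y = M y x"
  by (simp only: M chain_kernel_sym[of A B C D x y])

lemma row_sum:
  "x \<in> A \<Longrightarrow> (\<Sum>y\<in>V. M x y * f y) = 2 * sum f B"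
  "x \<in> B \<Longrightarrow> (\<Sum>y\<in>V. M x y * f y) = 2 * sum f A + 3 * sum f C"
  "x \<in> C \<Longrightarrow> (\<Sum>y\<in>V. M x y * f y) = 3 * sum f B + 2 * sum f D"
  "x \<in> D \<Longrightarrow> (\<Sum>y\<in>V. M x y * f y) = 2 * sum f C"
proof -
  have restrict: "(\<Sum>y\<in>V. if y \<in> Z then c * f y else 0) = c * sum f Z" if "Z \<subseteq> V" for Z c
    using sum.inter_restrict[OF fin, of "\<lambda>y. c * f y" Z] that by (simp add: sum_distrib_left Int_absorb1)
  have sub: "A \<subseteq> V" "B \<subseteq> V" "C \<subseteq> V" "D \<subseteq> V" using V by auto
  show "(\<Sum>y\<in>V. M x y * f y) = 2 * sum f B" if x: "x \<in> A"
  proof -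
    have "(\<Sum>y\<in>V. M x y * f y) = (\<Sum>y\<in>V. if y \<in> B then 2 * f y else 0)"
      using x sub(1) blocks_disjoint(1)[OF x] by (intro sum.cong[OF refl]) (simp add: M subsetD chain_kernel_def)
    then show ?thesis by (simp add: restrict sub)
  qed
  show "(\<Sum>y\<in>V. M x y * f y) = 2 * sum f A + 3 * sum f C" if x: "x \<in> B"
  proof -
    have "(\<Sum>y\<in>V. M x y * f y) = (\<Sum>y\<in>V. (if y \<in> A then 2 * f y else 0) + (if y \<in> C then 3 * f y else 0))"
    proof (rule sum.cong[OF refl])
      fix y assume "y \<in> V"
      then show "M x y * f y = (if y \<in> A then 2 * f y else 0) + (if y \<in> C then 3 * f y else 0)"
        using x sub(2) blocks_disjoint(2)[OF x] blocks_disjoint(1)[of y] by (simp add: M subsetD chain_kernel_def)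
    qed
    then show ?thesis by (simp add: sum.distrib restrict sub)
  qed
  show "(\<Sum>y\<in>V. M x y * f y) = 3 * sum f B + 2 * sum f D" if x: "x \<in> C"
  proof -
    have "(\<Sum>y\<in>V. M x y * f y) = (\<Sum>y\<in>V. (if y \<in> B then 3 * f y else 0) + (if y \<in> D then 2 * f y else 0))"
    proof (rule sum.cong[OF refl])
      fix y assume "y \<in> V"
      then show "M x y * f y = (if y \<in> B then 3 * f y else 0) + (if y \<in> D then 2 * f y else 0)"
        using x sub(3) blocks_disjoint(3)[OF x] blocks_disjoint(4)[of y] by (simp add: M subsetD chain_kernel_def)
    qed
    then show ?thesis by (simp add: sum.distrib restrict sub)
  qed
  show "(\<Sum>y\<in>V. M x y * f y) = 2 * sum f C" if x: "x \<in> D"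
  proof -
    have "(\<Sum>y\<in>V. M x y * f y) = (\<Sum>y\<in>V. if y \<in> C then 2 * f y else 0)"
      using x sub(4) blocks_disjoint(4)[OF x] by (intro sum.cong[OF refl]) (simp add: M subsetD chain_kernel_def)
    then show ?thesis by (simp add: restrict sub)
  qed
qed

definition "P = real (card A) * real (card B)"
definition "Q = real (card C) * real (card D)"
definition "R = real (card B) * real (card C)"

lemma PQR_pos: "P > 0" "Q > 0" "R > 0"
  using nonempty finite_blocks by (simp_all add: P_def Q_def R_def card_gt_0_iff)

definition eigenfun :: "real \<Rightarrow> ('a \<Rightarrow> real) \<Rightarrow> bool" where
  "eigenfun \<mu> f \<longleftrightarrow> (\<forall>x\<in>V. (\<Sum>y\<in>V. M x y * f y) = \<mu> * f x)"

text \<open>Rows are constant on each block, so summing the eigenvalue equation over a block gives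
  the linear system of the 4 by 4 quotient matrix.\<close>

lemma eigenfun_block_sums:
  assumes "eigenfun \<mu> f"
  shows "\<mu> * sum f A = 2 * real (card A) * sum f B"
    "\<mu> * sum f B = real (card B) * (2 * sum f A + 3 * sum f C)"
    "\<mu> * sum f C = real (card C) * (3 * sum f B + 2 * sum f D)"
    "\<mu> * sum f D = 2 * real (card D) * sum f C"
proof -
  have *: "\<mu> * f x = (\<Sum>y\<in>V. M x y * f y)" if "x \<in> V" for x
    using assms that by (simp add: eigenfun_def)
  have block: "\<mu> * sum f Z = real (card Z) * c" if "\<And>x. x \<in> Z \<Longrightarrow> \<mu> * f x = c" for Z c
    using that by (simp add: sum_distrib_left)
  have "\<mu> * sum f A = real (card A) * (2 * sum f B)"
    by (rule block) (simp add: * in_V row_sum(1))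
  then show "\<mu> * sum f A = 2 * real (card A) * sum f B" by simp
  have "\<mu> * sum f B = real (card B) * (2 * sum f A + 3 * sum f C)"
    by (rule block) (simp add: * in_V row_sum(2))
  then show "\<mu> * sum f B = real (card B) * (2 * sum f A + 3 * sum f C)" by simp
  have "\<mu> * sum f C = real (card C) * (3 * sum f B + 2 * sum f D)"
    by (rule block) (simp add: * in_V row_sum(3))
  then show "\<mu> * sum f C = real (card C) * (3 * sum f B + 2 * sum f D)" by simp
  have "\<mu> * sum f D = real (card D) * (2 * sum f C)"
    by (rule block) (simp add: * in_V row_sum(4))
  then show "\<mu> * sum f D = 2 * real (card D) * sum f C" by simp
qed

text \<open>For \<open>\<mu> > 0\<close> the quotient equations compute the other three block sums
  from the one over \<open>B\<close>, and the eigenvalue equation then recovers \<open>f\<close>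
  pointwise. Eigenspaces of positive eigenvalues therefore have dimension at most one.\<close>

lemma eigenfun_zero:
  assumes f: "eigenfun \<mu> f" and \<mu>: "\<mu> > 0" and B: "sum f B = 0" and x: "x \<in> V"
  shows "f x = 0"
proof -
  note s = eigenfun_block_sums[OF f]
  have A0: "sum f A = 0" using s(1) B \<mu> by simp
  have C0: "sum f C = 0" using s(2) A0 B \<mu> nonempty finite_blocks by simp
  have D0: "sum f D = 0" using s(4) C0 \<mu> by simp
  have "(\<Sum>y\<in>V. M x y * f y) = 0"
    using x row_sum[of x f] A0 B C0 D0 V by auto
  then have "\<mu> * f x = 0" using f x by (simp add: eigenfun_def)
  then show ?thesis using \<mu> by simp
qed

text \<open>Eliminating the end blocks \<open>A\<close> and \<open>D\<close> leaves two linear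
  equations in the sums over \<open>B\<close> and \<open>C\<close>. Their solvability is the
  determinant condition
  \<open>(\<mu>^2 - 4 * P) * (\<mu>^2 - 4 * Q) = 9 * R * \<mu>^2\<close>.\<close>

lemma eigenfun_characteristic:
  assumes f: "eigenfun \<mu> f" and \<mu>: "\<mu> > 0" and B: "sum f B \<noteq> 0"
  shows "(\<mu>\<^sup>2)\<^sup>2 - (4 * P + 4 * Q + 9 * R) * \<mu>\<^sup>2 + 16 * P * Q = 0"
proof -
  note s = eigenfun_block_sums[OF f]
  have "\<mu> * (\<mu> * sum f B) = 2 * real (card B) * (\<mu> * sum f A) + 3 * real (card B) * \<mu> * sum f C"
    unfolding s(2) by (simp add: algebra_simps)
  then have 1: "(\<mu>\<^sup>2 - 4 * P) * sum f B = 3 * real (card B) * \<mu> * sum f C"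
    unfolding s(1) P_def by (simp add: algebra_simps power2_eq_square)
  have "\<mu> * (\<mu> * sum f C) = 2 * real (card C) * (\<mu> * sum f D) + 3 * real (card C) * \<mu> * sum f B"
    unfolding s(3) by (simp add: algebra_simps)
  then have 2: "(\<mu>\<^sup>2 - 4 * Q) * sum f C = 3 * real (card C) * \<mu> * sum f B"
    unfolding s(4) Q_def by (simp add: algebra_simps power2_eq_square)
  have "(\<mu>\<^sup>2 - 4 * Q) * ((\<mu>\<^sup>2 - 4 * P) * sum f B) = 3 * real (card B) * \<mu> * ((\<mu>\<^sup>2 - 4 * Q) * sum f C)"
    unfolding 1 by (simp add: algebra_simps)
  also have "\<dots> = 9 * R * \<mu>\<^sup>2 * sum f B"
    unfolding 2 R_def by (simp add: algebra_simps power2_eq_square)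
  finally have "((\<mu>\<^sup>2 - 4 * Q) * (\<mu>\<^sup>2 - 4 * P)) * sum f B = (9 * R * \<mu>\<^sup>2) * sum f B"
    by (simp add: mult.assoc)
  then have "(\<mu>\<^sup>2 - 4 * Q) * (\<mu>\<^sup>2 - 4 * P) = 9 * R * \<mu>\<^sup>2"
    using B by simp
  moreover have "(\<mu>\<^sup>2)\<^sup>2 - (4 * P + 4 * Q + 9 * R) * \<mu>\<^sup>2 + 16 * P * Q =
      (\<mu>\<^sup>2 - 4 * Q) * (\<mu>\<^sup>2 - 4 * P) - 9 * R * \<mu>\<^sup>2"
    by (simp add: algebra_simps power2_eq_square)
  ultimately show ?thesis by simp
qed

lemma eigenfun_exists:
  assumes \<mu>: "\<mu> > 0" and eq: "(\<mu>\<^sup>2)\<^sup>2 - (4 * P + 4 * Q + 9 * R) * \<mu>\<^sup>2 + 16 * P * Q = 0"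
  obtains f where "eigenfun \<mu> f" "(\<Sum>x\<in>V. f x * f x) > 0"
proof -
  \<comment> \<open>The block values solve the equations of the rows in \<open>A\<close>,
    \<open>B\<close> and \<open>D\<close>, scaled by \<open>3 * card C * \<mu>\<close> so that only
    \<open>d\<close> keeps a denominator. The equation of the rows in \<open>C\<close> is then
    exactly the quadratic condition.\<close>
  define a where "a = 6 * R"
  define b where "b = 3 * real (card C) * \<mu>"
  define c where "c = \<mu>\<^sup>2 - 4 * P"
  define d where "d = 2 * real (card C) * (\<mu>\<^sup>2 - 4 * P) / \<mu>"
  define f where "f x = (if x \<in> A then a else if x \<in> B then b else if x \<in> C then c else d)" for x
  have fA: "f x = a" if "x \<in> A" for x using that by (simp add: f_def)
  have fB: "f x = b" if "x \<in> B" for x using blocks_disjoint(2)[OF that] that by (simp add: f_def)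
  have fC: "f x = c" if "x \<in> C" for x using blocks_disjoint(3)[OF that] that by (simp add: f_def)
  have fD: "f x = d" if "x \<in> D" for x using blocks_disjoint(4)[OF that] by (simp add: f_def)
  have s: "sum f A = card A * a" "sum f B = card B * b" "sum f C = card C * c" "sum f D = card D * d"
    by (simp_all add: fA fB fC fD)
  have "\<mu> * d = 2 * real (card C) * c" using \<mu> by (simp add: d_def c_def)
  then have "\<mu> * (3 * (card B * b) + 2 * (card D * d)) =
      3 * card B * \<mu> * b + 2 * card D * (2 * real (card C) * c)"
    by (simp add: distrib_left mult_ac)
  also have "\<dots> = 9 * R * \<mu>\<^sup>2 + 4 * Q * c"
    by (simp add: b_def Q_def R_def power2_eq_square)
  also have "\<dots> = \<mu> * (\<mu> * c) -
      ((\<mu>\<^sup>2)\<^sup>2 - (4 * P + 4 * Q + 9 * R) * \<mu>\<^sup>2 + 16 * P * Q)"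
    by (simp add: c_def algebra_simps power2_eq_square)
  finally have C': "\<mu> * c = 3 * (card B * b) + 2 * (card D * d)" using \<mu> unfolding eq by simp
  have "eigenfun \<mu> f"
    unfolding eigenfun_def
  proof
    fix x assume "x \<in> V"
    then consider "x \<in> A" | "x \<in> B" | "x \<in> C" | "x \<in> D" using V by auto
    then show "(\<Sum>y\<in>V. M x y * f y) = \<mu> * f x"
    proof cases
      case 1 then show ?thesis by (simp add: row_sum(1) s fA a_def b_def R_def)
    next
      case 2
      have "2 * (card A * a) + 3 * (card C * c) = \<mu> * b"
        by (simp add: a_def b_def c_def P_def R_def algebra_simps power2_eq_square)
      with 2 show ?thesis by (simp only: row_sum(2) s fB)
    next
      case 3 then show ?thesis using C' by (simp add: row_sum(3) s fC)
    next
      case 4 then show ?thesis using \<mu> by (simp add: row_sum(4) s fD c_def d_def)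
    qed
  qed
  moreover have "(\<Sum>x\<in>V. f x * f x) > 0"
  proof -
    obtain x where x: "x \<in> B" using nonempty by auto
    have "b \<noteq> 0" using \<mu> nonempty finite_blocks by (simp add: b_def)
    then have "f x * f x > 0"
      unfolding fB[OF x] using zero_less_power2[of b] unfolding power2_eq_square by blast
    moreover have "x \<in> V" using x V by blast
    ultimately show ?thesis by (intro sum_pos2[OF fin, of x]) simp_all
  qed
  ultimately show thesis by (rule that)
qed

lemma bilin_eigenfun:
  assumes "eigenfun \<mu> g"
  shows "bilin V M f g = \<mu> * (\<Sum>x\<in>V. f x * g x)"
proof -
  have "bilin V M f g = (\<Sum>x\<in>V. f x * (\<mu> * g x))"
    unfolding bilin_def by (rule sum.cong[OF refl]) (use assms in \<open>simp add: eigenfun_def\<close>)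
  then show ?thesis by (simp add: sum_distrib_left mult.left_commute)
qed

text \<open>Eigenfunctions for the two positive roots \<open>m1 > m2\<close> serve as test functions
  and bound the second eigenvalue from below by \<open>m2\<close>. If it were larger, the first two
  eigenvalues would both be \<open>m1\<close>, contradicting the simplicity of positive
  eigenvalues.\<close>

lemma second_eigenvalue:
  assumes vs: "distinct vs" "set vs = V"
  shows "eigenvalues_desc (mat (card V) (card V) (\<lambda>(i, j). M (vs ! i) (vs ! j))) ! 1 =
    sqrt (((4 * P + 4 * Q + 9 * R) - sqrt ((4 * P + 4 * Q + 9 * R)\<^sup>2 - 64 * P * Q)) / 2)"
proof -
  define es where "es = eigenvalues_desc (mat (card V) (card V) (\<lambda>(i, j). M (vs ! i) (vs ! j)))"
  define n where "n = card V"
  define S where "S = 4 * P + 4 * Q + 9 * R"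
  define \<Delta> where "\<Delta> = S\<^sup>2 - 64 * P * Q"
  define t1 t2 where "t1 = (S + sqrt \<Delta>) / 2" and "t2 = (S - sqrt \<Delta>) / 2"
  \<comment> \<open>Written in this way the discriminant is visibly positive, so \<open>t1\<close>
    and \<open>t2\<close> are distinct.\<close>
  have "\<Delta> = (4 * P - 4 * Q)\<^sup>2 + 9 * R * (8 * P + 8 * Q + 9 * R)"
    by (simp add: \<Delta>_def S_def algebra_simps power2_eq_square)
  moreover have "9 * R * (8 * P + 8 * Q + 9 * R) > 0"
    using PQR_pos by (intro mult_pos_pos) auto
  ultimately have \<Delta>: "\<Delta> > 0" by (simp add: add_nonneg_pos)
  have S: "S > 0" using PQR_pos by (simp add: S_def)
  have "sqrt \<Delta> < S"
    using PQR_pos S by (intro real_less_lsqrt) (auto simp: \<Delta>_def)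
  then have t: "0 < t2" "t2 < t1" using \<Delta> by (auto simp: t1_def t2_def)
  have fact: "t\<^sup>2 - S * t + 16 * P * Q = (t - t1) * (t - t2)" for t
  proof -
    have "sqrt \<Delta> * sqrt \<Delta> = S\<^sup>2 - 64 * P * Q" using \<Delta> by (simp add: \<Delta>_def)
    then show ?thesis by (simp add: t1_def t2_def field_simps power2_eq_square)
  qed
  define m1 m2 where "m1 = sqrt t1" and "m2 = sqrt t2"
  have m: "0 < m2" "m2 < m1" using t by (auto simp: m1_def m2_def)
  have mm: "m1\<^sup>2 = t1" "m2\<^sup>2 = t2" using t by (auto simp: m1_def m2_def)
  have n2: "2 \<le> n"
  proof -
    have "card A > 0" "card B > 0" using nonempty finite_blocks by (auto simp: card_gt_0_iff)
    moreover have "card (A \<union> B) \<le> n" unfolding n_def using V fin by (intro card_mono) auto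
    ultimately show ?thesis using card_Un_disjoint[OF finite_blocks(1,2) disj(1)] by linarith
  qed
  have sp: "length es = n" "sorted_wrt (\<ge>) es"
    unfolding es_def n_def by (rule real_symmetric_eigenbasis[OF vs]; rule M_sym; assumption)+
  have "m1 > 0" using m by simp
  have "(m1\<^sup>2)\<^sup>2 - (4 * P + 4 * Q + 9 * R) * m1\<^sup>2 + 16 * P * Q = 0"
    unfolding mm S_def[symmetric] fact by simp
  then obtain f where f: "eigenfun m1 f" "(\<Sum>x\<in>V. f x * f x) > 0"
    using eigenfun_exists[OF \<open>m1 > 0\<close>] by blast
  have "(m2\<^sup>2)\<^sup>2 - (4 * P + 4 * Q + 9 * R) * m2\<^sup>2 + 16 * P * Q = 0"
    unfolding mm S_def[symmetric] fact by simp
  then obtain g where g: "eigenfun m2 g" "(\<Sum>x\<in>V. g x * g x) > 0"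
    using eigenfun_exists[OF m(1)] by blast
  have fg: "(\<Sum>x\<in>V. f x * g x) = 0"
  proof -
    have "bilin V M f g = bilin V M g f" by (rule bilin_sym) (rule M_sym)
    then have "m2 * (\<Sum>x\<in>V. f x * g x) = m1 * (\<Sum>x\<in>V. f x * g x)"
      by (simp add: bilin_eigenfun[OF f(1)] bilin_eigenfun[OF g(1)] mult.commute)
    then show ?thesis using m by simp
  qed
  have lower: "m2 \<le> es ! 1"
    unfolding es_def
  proof (rule second_eigenvalue_ge[OF vs])
    show "2 \<le> card V" using n2 by (simp add: n_def)
    show "m2 * (\<Sum>x\<in>V. f x * f x) \<le> bilin V M f f"
      using m f(2) by (simp add: bilin_eigenfun[OF f(1)])
    show "m2 * (\<Sum>x\<in>V. g x * g x) \<le> bilin V M g g"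
      by (simp add: bilin_eigenfun[OF g(1)])
    show "bilin V M f g = 0" by (simp add: bilin_eigenfun[OF g(1)] fg)
  qed (use f g fg M_sym in auto)
  have "\<exists>u. (\<forall>k<n. \<forall>x\<in>V. (\<Sum>y\<in>V. M x y * u k y) = es ! k * u k x) \<and>
         (\<forall>j<n. \<forall>k<n. (\<Sum>x\<in>V. u j x * u k x) = (if j = k then 1 else 0)) \<and>
         (\<forall>x\<in>V. \<forall>y\<in>V. (\<Sum>k<n. u k x * u k y) = (if x = y then 1 else 0))"
    unfolding es_def n_def by (rule real_symmetric_eigenbasis(3)[OF vs]) (rule M_sym)
  then obtain u where u0: "\<forall>k<n. \<forall>x\<in>V. (\<Sum>y\<in>V. M x y * u k y) = es ! k * u k x"
    and orth: "\<forall>j<n. \<forall>k<n. (\<Sum>x\<in>V. u j x * u k x) = (if j = k then 1 else 0)"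
    by (elim exE conjE)
  have upper: "es ! 1 \<le> m2"
  proof (rule ccontr)
    assume "\<not> es ! 1 \<le> m2"
    then have e1: "es ! 1 > m2" by simp
    have "es ! 1 \<le> es ! 0" using sp n2 by (intro sorted_wrt_nth_less[of "(\<ge>)"]) auto
    then have e0: "es ! 0 > m2" using e1 by simp
    have ef: "eigenfun (es ! k) (u k)" if "k < n" for k using u0 that by (simp add: eigenfun_def)
    have nz: "sum (u k) B \<noteq> 0" if k: "k < 2" for k
    proof
      assume "sum (u k) B = 0"
      moreover have "k < n" using k n2 by simp
      moreover have "es ! k > 0" using e0 e1 m k by (cases k) auto
      ultimately have "u k x = 0" if "x \<in> V" for x using eigenfun_zero[OF ef] that by blast
      then have "(\<Sum>x\<in>V. u k x * u k x) = 0" by simp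
      then show False using orth \<open>k < n\<close> by simp
    qed
    have val: "es ! k = m1" if k: "k < 2" for k
    proof -
      have p: "es ! k > m2" using e0 e1 k by (cases k) auto
      have "k < n" using k n2 by simp
      have "((es ! k)\<^sup>2)\<^sup>2 - S * (es ! k)\<^sup>2 + 16 * P * Q = 0"
        unfolding S_def by (rule eigenfun_characteristic[OF ef[OF \<open>k < n\<close>] _ nz[OF k]]) (use p m in simp)
      then have "(es ! k)\<^sup>2 = t1 \<or> (es ! k)\<^sup>2 = t2" unfolding fact by simp
      moreover have "(es ! k)\<^sup>2 > t2" using power_strict_mono[OF p, of 2] m mm(2) by simp
      ultimately have "(es ! k)\<^sup>2 = m1\<^sup>2" using mm by auto
      then show ?thesis using p m by (simp add: power2_eq_iff_nonneg)
    qed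
    \<comment> \<open>The combination whose sum over \<open>B\<close> vanishes. As an eigenfunction
      for \<open>m1\<close> it must be zero, which the orthonormality of \<open>u 0\<close> and
      \<open>u 1\<close> forbids.\<close>
    define h where "h x = sum (u 1) B * u 0 x - sum (u 0) B * u 1 x" for x
    have h1: "eigenfun m1 h"
      unfolding eigenfun_def
    proof
      fix x assume x: "x \<in> V"
      have "(\<Sum>y\<in>V. M x y * h y) =
          sum (u 1) B * (\<Sum>y\<in>V. M x y * u 0 y) - sum (u 0) B * (\<Sum>y\<in>V. M x y * u 1 y)"
        by (simp add: h_def sum_distrib_left sum_subtractf algebra_simps)
      also have "\<dots> = m1 * h x"
        using ef[of 0] ef[of 1] val n2 x by (simp add: eigenfun_def h_def algebra_simps)
      finally show "(\<Sum>y\<in>V. M x y * h y) = m1 * h x" .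
    qed
    have h2: "sum h B = 0"
      by (simp add: h_def sum_subtractf sum_distrib_left[symmetric])
    have h0: "h x = 0" if "x \<in> V" for x
      by (rule eigenfun_zero[OF h1 _ h2 that]) (use m in linarith)
    then have "(\<Sum>x\<in>V. h x * u 0 x) = 0" by simp
    moreover have "(\<Sum>x\<in>V. h x * u 0 x) =
        sum (u 1) B * (\<Sum>x\<in>V. u 0 x * u 0 x) - sum (u 0) B * (\<Sum>x\<in>V. u 1 x * u 0 x)"
      by (simp add: h_def sum_distrib_left sum_subtractf algebra_simps)
    ultimately have "sum (u 1) B = 0" using orth n2 by simp
    then show False using nz[of 1] by simp
  qed
  have "es ! 1 = m2" using lower upper by simp
  then have "es ! 1 = sqrt ((S - sqrt \<Delta>) / 2)" unfolding m2_def t2_def .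
  then show ?thesis unfolding es_def S_def \<Delta>_def .
qed

end

section \<open>Distances in graphs and trees\<close>

text \<open>The distance as a natural number, for use in inductions and linear arithmetic. It is
  unspecified if \<open>v\<close> cannot be reached from \<open>u\<close>.\<close>

definition hop :: "'a rel \<Rightarrow> 'a \<Rightarrow> 'a \<Rightarrow> nat" where
  "hop R u v = (LEAST k. (u, v) \<in> R ^^ k)"

lemma hop_le: "(u, v) \<in> R ^^ k \<Longrightarrow> hop R u v \<le> k"
  unfolding hop_def by (rule Least_le)

lemma hop_relpow: "(u, v) \<in> R\<^sup>* \<Longrightarrow> (u, v) \<in> R ^^ hop R u v"
  unfolding hop_def by (metis LeastI rtrancl_imp_relpow)

context pair_wf_digraph
begin

lemma awalk_relpow: "awalk u p v \<Longrightarrow> (u, v) \<in> parcs G ^^ length p"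
proof (induction p arbitrary: u)
  case Nil
  then show ?case by (simp add: awalk_Nil_iff)
next
  case (Cons e p)
  then have "(u, snd e) \<in> parcs G" "(snd e, v) \<in> parcs G ^^ length p"
    by (auto simp: awalk_Cons_iff)
  then show ?case using relpow_Suc_I2 by fastforce
qed

lemma relpow_awalk: "u \<in> pverts G \<Longrightarrow> (u, v) \<in> parcs G ^^ k \<Longrightarrow> \<exists>p. awalk u p v \<and> length p = k"
proof (induction k arbitrary: u)
  case 0
  then show ?case by (simp add: awalk_Nil_iff)
next
  case (Suc k)
  obtain w where w: "(u, w) \<in> parcs G" "(w, v) \<in> parcs G ^^ k"
    using relpow_Suc_D2[OF Suc.prems(2)] by blast
  obtain p where p: "awalk w p v" "length p = k"
    using Suc.IH[OF _ w(2)] in_arcsD2[OF w(1)] by blast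
  have "awalk u ((u, w) # p) v" using w(1) p(1) by (simp add: awalk_Cons_iff)
  then show ?case using p(2) by (intro exI[of _ "(u, w) # p"]) simp
qed

text \<open>With unit weights the cost of a walk is its length, so the infimum over all walks is
  attained at a shortest one.\<close>

lemma graph_dist_hop:
  assumes u: "u \<in> pverts G" and uv: "(u, v) \<in> (parcs G)\<^sup>*"
  shows "graph_dist G u v = real (hop (parcs G) u v)"
proof -
  have cost: "awalk_cost (\<lambda>_. 1) p = real (length p)" for p :: "('a \<times> 'a) list"
    by (induction p) simp_all
  obtain p where p: "awalk u p v" "length p = hop (parcs G) u v"
    using relpow_awalk[OF u hop_relpow[OF uv]] by blast
  have "\<mu> (\<lambda>_. 1) u v = ereal (real (hop (parcs G) u v))"
  proof (rule antisym)
    show "\<mu> (\<lambda>_. 1) u v \<le> ereal (real (hop (parcs G) u v))"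
      using min_cost_le_walk_cost[OF p(1), of "\<lambda>_. 1"] by (simp add: cost p(2))
    show "ereal (real (hop (parcs G) u v)) \<le> \<mu> (\<lambda>_. 1) u v"
      unfolding \<mu>_def using hop_le[OF awalk_relpow] by (intro INF_greatest) (simp add: cost)
  qed
  then show ?thesis by (simp add: graph_dist_def)
qed

lemma rtrancl_awalk:
  assumes "(x, y) \<in> S\<^sup>*" "S \<subseteq> parcs G" "y \<in> pverts G"
  shows "\<exists>p. awalk x p y \<and> set p \<subseteq> S"
  using assms(1)
proof (induction rule: converse_rtrancl_induct)
  case base
  show ?case by (rule exI[of _ "[]"]) (simp add: awalk_Nil_iff assms(3))
next
  case (step x w)
  then obtain p where p: "awalk w p y" "set p \<subseteq> S" by blast
  have "awalk x ((x, w) # p) y" using p(1) step(1) assms(2) by (auto simp: awalk_Cons_iff)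
  then show ?case using p(2) step(1) by (intro exI[of _ "(x, w) # p"]) simp
qed

end

text \<open>If the ends of an edge stayed connected after deleting both of its arcs, a path between
  them would close up with the edge to a cycle. That path is not a single arc, so the cycle has
  length at least 3 and is not a mere traversal of the edge in both directions.\<close>

lemma undirected_tree_no_detour:
  assumes "undirected_tree T" and uv: "(u, v) \<in> parcs T"
  shows "(u, v) \<notin> (parcs T - {(u, v), (v, u)})\<^sup>*"
proof
  assume star: "(u, v) \<in> (parcs T - {(u, v), (v, u)})\<^sup>*"
  interpret pair_graph T using assms(1) by (simp add: undirected_tree_def)
  have no_cycle: "\<not> (\<exists>p. cycle p \<and> 3 \<le> length p)"
    using assms(1) by (simp add: undirected_tree_def)
  obtain q where q: "awalk u q v" "set q \<subseteq> parcs T - {(u, v), (v, u)}"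
    using rtrancl_awalk[OF star] in_arcsD2[OF uv] by blast
  define p where "p = awalk_to_apath q"
  have p: "apath u p v" "set p \<subseteq> parcs T - {(u, v), (v, u)}"
    using apath_awalk_to_apath[OF q(1)] awalk_to_apath_subset[OF q(1)] q(2) by (auto simp: p_def)
  have "u \<noteq> v" using no_loops'[of u] uv by blast
  have "2 \<le> length p"
  proof (rule ccontr)
    assume "\<not> 2 \<le> length p"
    then consider "p = []" | e where "p = [e]"
      by (cases p; cases "tl p") auto
    then show False
    proof cases
      case 1
      then show False using p(1) \<open>u \<noteq> v\<close> by (simp add: apath_Nil_iff)
    next
      case 2
      then have "e = (u, v)" using p(1) by (cases e) (simp add: apath_Cons_iff apath_Nil_iff)
      then show False using p(2) 2 by simp
    qed
  qed
  moreover have "cycle ((v, u) # p)"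
    unfolding cycle_def
    using p(1) arcs_symmetric[OF uv] by (intro exI[of _ v]) (auto simp: apath_def awalk_Cons_iff)
  ultimately show False using no_cycle by (auto intro!: exI[of _ "(v, u) # p"])
qed

section \<open>The metric of a connected graph, and distance levels in trees\<close>

locale connected_rel =
  fixes V :: "'a set" and R :: "'a rel"
  assumes finV: "finite V" and sub: "R \<subseteq> V \<times> V"
    and irrefl: "(x, x) \<notin> R"
    and symR: "(x, y) \<in> R \<Longrightarrow> (y, x) \<in> R"
    and conn: "x \<in> V \<Longrightarrow> y \<in> V \<Longrightarrow> (x, y) \<in> R\<^sup>*"
begin

abbreviation "d \<equiv> hop R"

lemma inV: "(x, y) \<in> R \<Longrightarrow> x \<in> V" "(x, y) \<in> R \<Longrightarrow> y \<in> V"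
  using sub by auto

lemma relpow_d: "x \<in> V \<Longrightarrow> y \<in> V \<Longrightarrow> (x, y) \<in> R ^^ d x y"
  by (rule hop_relpow[OF conn])

lemma d_self [simp]: "d x x = 0"
  using hop_le[of x x 0 R] by simp

lemma d_eq_0: "x \<in> V \<Longrightarrow> y \<in> V \<Longrightarrow> d x y = 0 \<longleftrightarrow> x = y"
  using relpow_d[of x y] by auto

lemma sym_relpow: "(x, y) \<in> R ^^ k \<Longrightarrow> (y, x) \<in> R ^^ k"
proof (induction k arbitrary: x)
  case (Suc k)
  obtain w where "(x, w) \<in> R" "(w, y) \<in> R ^^ k" using relpow_Suc_D2[OF Suc.prems] by blast
  then show ?case using relpow_Suc_I[OF Suc.IH symR] by blast
qed simp

lemma d_sym: "x \<in> V \<Longrightarrow> y \<in> V \<Longrightarrow> d x y = d y x"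
  by (rule antisym; rule hop_le, rule sym_relpow, rule relpow_d)

lemma d_step:
  assumes "x \<in> V" "(y, z) \<in> R"
  shows "d x z \<le> Suc (d x y)"
  by (rule hop_le, rule relpow_Suc_I[OF relpow_d assms(2)]) (use assms inV in auto)

lemma d_triangle: "x \<in> V \<Longrightarrow> y \<in> V \<Longrightarrow> z \<in> V \<Longrightarrow> d x z \<le> d x y + d y z"
  by (rule hop_le) (use relpow_d[of x y] relpow_d[of y z] in \<open>auto simp: relpow_add\<close>)

lemma d_eq_1: "x \<in> V \<Longrightarrow> y \<in> V \<Longrightarrow> d x y = 1 \<longleftrightarrow> (x, y) \<in> R"
proof
  assume V: "x \<in> V" "y \<in> V"
  show "(x, y) \<in> R" if "d x y = 1" using relpow_d[OF V] that by simp
  assume xy: "(x, y) \<in> R"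
  then have "d x y \<le> 1" using hop_le[of x y 1 R] by simp
  moreover have "d x y \<noteq> 0" using d_eq_0[OF V] xy irrefl by blast
  ultimately show "d x y = 1" by simp
qed

lemma d_pred:
  assumes "x \<in> V" "y \<in> V" "d x y = Suc k"
  obtains z where "(z, y) \<in> R" "z \<in> V" "d x z = k"
proof -
  obtain z where z: "(x, z) \<in> R ^^ k" "(z, y) \<in> R"
    using relpow_d[OF assms(1,2)] unfolding assms(3) by (rule relpow_Suc_E)
  have "d x z \<le> k" using hop_le[OF z(1)] .
  moreover have "Suc k \<le> Suc (d x z)" using d_step[OF assms(1) z(2)] assms(3) by simp
  ultimately show thesis using that[OF z(2)] inV(1)[OF z(2)] by simp
qed

lemma d_eq_2:
  assumes "x \<in> V" "y \<in> V" "x \<noteq> y" "(x, y) \<notin> R" "(x, z) \<in> R" "(z, y) \<in> R"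
  shows "d x y = 2"
proof -
  have "d x y \<le> 2" using hop_le[of x y 2 R] assms(5,6) by (auto simp: numeral_2_eq_2)
  moreover have "d x y \<noteq> 0" "d x y \<noteq> 1" using d_eq_0 d_eq_1 assms by auto
  ultimately show ?thesis by linarith
qed

lemma d_eq_3:
  assumes "x \<in> V" "y \<in> V" "x \<noteq> y" "(x, y) \<notin> R" "\<And>z. (x, z) \<in> R \<Longrightarrow> (z, y) \<notin> R"
    and "(x, u) \<in> R" "(u, w) \<in> R" "(w, y) \<in> R"
  shows "d x y = 3"
proof -
  have "d x y \<le> 3" using hop_le[of x y 3 R] assms(6-8) by (auto simp: numeral_3_eq_3)
  moreover have "d x y \<noteq> 0" "d x y \<noteq> 1" using d_eq_0 d_eq_1 assms by auto
  moreover have "d x y \<noteq> 2"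
  proof
    assume "d x y = 2"
    then have "(x, y) \<in> R O R" using relpow_d[OF assms(1,2)] by (simp add: numeral_2_eq_2)
    then show False using assms(5) by blast
  qed
  ultimately show ?thesis by linarith
qed

end

text \<open>Acyclicity in the form in which it is used: every edge is a bridge.\<close>

locale tree_rel = connected_rel +
  assumes no_detour: "(x, y) \<in> R \<Longrightarrow> (x, y) \<notin> (R - {(x, y), (y, x)})\<^sup>*"
begin

text \<open>The intersected set records which arcs a shortest path from \<open>r\<close> uses: each
  one changes the level, and none goes beyond the level of \<open>x\<close>. Such a path avoids
  every edge inside a level and every edge with an end beyond the level of \<open>x\<close>.\<close>

lemma geodesic:
  assumes "r \<in> V" "x \<in> V"
  shows "(r, x) \<in> (R \<inter> {(a, b). d r a \<le> d r x \<and> d r b \<le> d r x \<and> d r a \<noteq> d r b})\<^sup>*"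
  using assms(2)
proof (induction "d r x" arbitrary: x)
  case 0
  then have "r = x" using d_eq_0[OF assms(1) 0(2)] by simp
  then show ?case by simp
next
  case (Suc k)
  obtain z where z: "(z, x) \<in> R" "z \<in> V" "d r z = k"
    using d_pred[OF assms(1) Suc.prems] Suc.hyps(2) by metis
  have "(r, z) \<in> (R \<inter> {(a, b). d r a \<le> d r z \<and> d r b \<le> d r z \<and> d r a \<noteq> d r b})\<^sup>*"
    using Suc.hyps(1)[of z] z by simp
  then have "(r, z) \<in> (R \<inter> {(a, b). d r a \<le> d r x \<and> d r b \<le> d r x \<and> d r a \<noteq> d r b})\<^sup>*"
    by (rule rtrancl_mono[THEN subsetD, rotated]) (use z(3) Suc.hyps(2) in auto)
  moreover have "(z, x) \<in> R \<inter> {(a, b). d r a \<le> d r x \<and> d r b \<le> d r x \<and> d r a \<noteq> d r b}"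
    using z Suc.hyps(2) by simp
  ultimately show ?case by (rule rtrancl_into_rtrancl)
qed

lemma sym_restricted: "(x, y) \<in> (R - {(u, v), (v, u)})\<^sup>* \<Longrightarrow> (y, x) \<in> (R - {(u, v), (v, u)})\<^sup>*"
proof -
  have "sym (R - {(u, v), (v, u)})" by (rule symI) (use symR in blast)
  then have "sym ((R - {(u, v), (v, u)})\<^sup>*)" by (rule sym_rtrancl)
  then show "(x, y) \<in> (R - {(u, v), (v, u)})\<^sup>* \<Longrightarrow> (y, x) \<in> (R - {(u, v), (v, u)})\<^sup>*" by (rule symD)
qed

text \<open>Shortest paths from \<open>r\<close> to \<open>x\<close> and to \<open>y\<close> avoid
  an edge inside a level, so their concatenation would be a detour around the edge.\<close>

lemma d_adjacent_neq:
  assumes r: "r \<in> V" and xy: "(x, y) \<in> R"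
  shows "d r x \<noteq> d r y"
proof
  assume eq: "d r x = d r y"
  have path: "(r, z) \<in> (R - {(x, y), (y, x)})\<^sup>*" if "z \<in> {x, y}" for z
  proof -
    have "z \<in> V" using that inV[OF xy] by blast
    from geodesic[OF r this] show ?thesis
      by (rule rtrancl_mono[THEN subsetD, rotated]) (use eq in auto)
  qed
  have "(x, y) \<in> (R - {(x, y), (y, x)})\<^sup>*"
    by (rule rtrancl_trans[OF sym_restricted[OF path] path]) simp_all
  then show False using no_detour[OF xy] by blast
qed

text \<open>Shortest paths to two parents stay below the level of \<open>z\<close>. For different
  parents, going from \<open>x\<close> through \<open>r\<close> and \<open>y\<close> to
  \<open>z\<close> would be a detour around the edge between \<open>x\<close> and
  \<open>z\<close>.\<close>

lemma parent_unique:
  assumes r: "r \<in> V" and xz: "(x, z) \<in> R" and yz: "(y, z) \<in> R"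
    and dx: "d r z = Suc (d r x)" and dy: "d r z = Suc (d r y)"
  shows "x = y"
proof (rule ccontr)
  assume "x \<noteq> y"
  have path: "(r, w) \<in> (R - {(x, z), (z, x)})\<^sup>*" if "w \<in> {x, y}" for w
  proof -
    have "w \<in> V" using that inV[OF xz] inV[OF yz] by blast
    from geodesic[OF r this] show ?thesis
      by (rule rtrancl_mono[THEN subsetD, rotated]) (use dx dy that in auto)
  qed
  have "(y, z) \<in> R - {(x, z), (z, x)}" using yz \<open>x \<noteq> y\<close> irrefl by auto
  moreover have "(x, y) \<in> (R - {(x, z), (z, x)})\<^sup>*"
    by (rule rtrancl_trans[OF sym_restricted[OF path] path]) simp_all
  ultimately have "(x, z) \<in> (R - {(x, z), (z, x)})\<^sup>*" by (simp add: rtrancl_into_rtrancl)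
  then show False using no_detour[OF xz] by blast
qed

text \<open>No neighbour of \<open>a\<close> lies on the same level as \<open>a\<close> seen from
  \<open>e\<close>, or beyond it, so all neighbours are parents of \<open>a\<close> and coincide
  with \<open>b\<close>. Hence \<open>a\<close> is a leaf, and every walk leaving it goes through
  \<open>b\<close>.\<close>

lemma diametral_leaf:
  assumes V: "a \<in> V" "e \<in> V" and max: "\<And>x. x \<in> V \<Longrightarrow> d e x \<le> d e a"
    and ab: "(a, b) \<in> R" and w: "w \<in> V" "w \<noteq> a"
  shows "d a w = Suc (d b w)"
proof -
  have closer: "d e a = Suc (d e x)" if "(a, x) \<in> R" for x
    using d_adjacent_neq[OF V(2) that] max[OF inV(2)[OF that]] d_step[OF V(2) symR[OF that]] by linarith
  have leaf: "x = b" if "(a, x) \<in> R" for x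
    using parent_unique[OF V(2) symR[OF that] symR[OF ab] closer[OF that] closer[OF ab]] .
  have "d w a \<noteq> 0" using d_eq_0[OF w(1) V(1)] w(2) by blast
  then obtain k where k: "d w a = Suc k" using not0_implies_Suc by blast
  obtain z where z: "(z, a) \<in> R" "d w z = k" using d_pred[OF w(1) V(1) k] by metis
  have "z = b" using leaf[OF symR[OF z(1)]] .
  then show ?thesis using k z d_sym[OF w(1) V(1)] d_sym[OF w(1) inV(2)[OF ab]] by simp
qed

text \<open>The ends of a longest shortest path are leaves, so distances from them reduce to
  distances from their neighbours \<open>b\<close> and \<open>c\<close>. These two may coincide, as
  in a star.\<close>

lemma diametral_path:
  assumes card: "2 \<le> card V"
  obtains a b c e where "(a, b) \<in> R" "(c, e) \<in> R" "a \<noteq> e"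
    "\<And>x y. x \<in> V \<Longrightarrow> y \<in> V \<Longrightarrow> d x y \<le> d a e"
    "\<And>w. w \<in> V \<Longrightarrow> w \<noteq> a \<Longrightarrow> d a w = Suc (d b w)"
    "\<And>w. w \<in> V \<Longrightarrow> w \<noteq> e \<Longrightarrow> d e w = Suc (d c w)"
proof -
  define Ds where "Ds = (\<lambda>(x, y). d x y) ` (V \<times> V)"
  have fin: "finite Ds" using finV by (simp add: Ds_def)
  obtain x0 y0 where xy: "x0 \<in> V" "y0 \<in> V" "x0 \<noteq> y0"
  proof -
    have "\<not> card V \<le> Suc 0" using card by simp
    then show thesis using that unfolding card_le_Suc0_iff_eq[OF finV] by blast
  qed
  then have "Ds \<noteq> {}" by (auto simp: Ds_def)
  then have "Max Ds \<in> Ds" using fin by (rule Max_in[rotated])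
  then obtain a e where ae: "a \<in> V" "e \<in> V" "d a e = Max Ds" by (auto simp: Ds_def)
  have max: "d x y \<le> d a e" if "x \<in> V" "y \<in> V" for x y
  proof -
    have "d x y \<in> Ds" using that by (force simp: Ds_def)
    then show ?thesis using Max_ge[OF fin] ae(3) by simp
  qed
  have "d x0 y0 \<noteq> 0" using d_eq_0 xy by blast
  then have "d a e \<noteq> 0" using max[OF xy(1,2)] by linarith
  then obtain k where k: "d a e = Suc k" using not0_implies_Suc by blast
  then have k': "d e a = Suc k" using d_sym ae by simp
  obtain c where c: "(c, e) \<in> R" using d_pred[OF ae(1,2) k] by metis
  obtain b where b: "(b, a) \<in> R" using d_pred[OF ae(2,1) k'] by metis
  show thesis
  proof (rule that[OF symR[OF b] c])
    show "a \<noteq> e" using k by auto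
    show "d a w = Suc (d b w)" if "w \<in> V" "w \<noteq> a" for w
      by (rule diametral_leaf[OF ae(1,2) _ symR[OF b] that]) (use max ae k k' in simp)
    show "d e w = Suc (d c w)" if "w \<in> V" "w \<noteq> e" for w
      by (rule diametral_leaf[OF ae(2,1) _ symR[OF c] that]) (use max ae in simp)
  qed (rule max)
qed

end

lemma tree_rel_of_undirected_tree:
  assumes "undirected_tree T"
  shows "tree_rel (pverts T) (parcs T)"
proof -
  interpret pair_graph T using assms by (simp add: undirected_tree_def)
  have sym: "(y, x) \<in> parcs T" if "(x, y) \<in> parcs T" for x y using arcs_symmetric[OF that] .
  have "(\<lambda>(x, y). (y, x)) ` parcs T \<subseteq> parcs T"
    by (rule image_subsetI, clarify, rule sym)
  \<comment> \<open>The library defines connectedness through the symmetric closure, which adds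
    nothing to a symmetric arc set.\<close>
  then have symcl: "(parcs T)\<^sup>s = parcs T" by (simp add: symcl_def Un_absorb2)
  have "Digraph_Component.connected (with_proj T)" using assms by (simp add: undirected_tree_def)
  then have conn: "\<forall>x\<in>pverts T. \<forall>y\<in>pverts T. (x, y) \<in> rtrancl_on (pverts T) (parcs T)"
    unfolding connected_conv with_proj_simps symcl by blast
  show ?thesis
  proof
    show "(x, y) \<in> (parcs T)\<^sup>*" if "x \<in> pverts T" "y \<in> pverts T" for x y
      using conn that rtrancl_on_rtranclI by metis
    show "parcs T \<subseteq> pverts T \<times> pverts T" using in_arcsD1 in_arcsD2 by fastforce
    show "(x, x) \<notin> parcs T" for x using no_loops' by blast
  qed (use undirected_tree_no_detour[OF assms] sym pair_finite_verts in blast)+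
qed

section \<open>Eccentricity matrices\<close>

context connected_rel
begin

definition ec :: "'a \<Rightarrow> nat" where "ec x = Max (d x ` V)"

lemma ec_eqI:
  assumes "\<And>w. w \<in> V \<Longrightarrow> d x w \<le> m" "w0 \<in> V" "d x w0 = m"
  shows "ec x = m"
  unfolding ec_def using assms finV by (intro Max_eqI) auto

context
  fixes G :: "'a pair_pre_digraph"
  assumes G: "pverts G = V" "parcs G = R"
begin

lemma graph_dist_eq: "x \<in> V \<Longrightarrow> y \<in> V \<Longrightarrow> graph_dist G x y = real (d x y)"
proof -
  assume V: "x \<in> V" "y \<in> V"
  interpret pair_wf_digraph G using inV by unfold_locales (auto simp: G)
  show ?thesis using graph_dist_hop[of x y] V conn[OF V] by (simp add: G)
qed

lemma ecc_entry_eq: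
  assumes "x \<in> V" "y \<in> V"
  shows "ecc_entry G x y = (if d x y = min (ec x) (ec y) then real (d x y) else 0)"
proof -
  have ecc: "eccentricity G x = real (ec x)" if x: "x \<in> V" for x
  proof -
    have "graph_dist G x ` V = real ` (d x ` V)"
      unfolding image_image using graph_dist_eq[OF x] by (intro image_cong) auto
    moreover have "real (Max (d x ` V)) = Max (real ` (d x ` V))"
      using finV x by (intro mono_Max_commute) (auto simp: mono_def)
    ultimately show ?thesis by (simp add: eccentricity_def ec_def G)
  qed
  show ?thesis
    using assms by (simp add: ecc_entry_def ecc graph_dist_eq flip: of_nat_min)
qed

lemma ecc_entry_sym: "x \<in> V \<Longrightarrow> y \<in> V \<Longrightarrow> ecc_entry G x y = ecc_entry G y x"
  using d_sym by (simp add: ecc_entry_eq min.commute)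

lemma vertex_list: "distinct (vertex_list G)" "set (vertex_list G) = V"
proof -
  have "\<exists>vs. distinct vs \<and> set vs = pverts G"
    using finite_distinct_list[OF finV] G by auto
  then have "distinct (vertex_list G) \<and> set (vertex_list G) = pverts G"
    unfolding vertex_list_def by (rule someI_ex)
  then show "distinct (vertex_list G)" "set (vertex_list G) = V" using G by auto
qed

lemma xi2_eq: "\<xi> 2 G = eigenvalues_desc (mat (card V) (card V)
    (\<lambda>(i, j). ecc_entry G (vertex_list G ! i) (vertex_list G ! j))) ! 1"
  by (simp add: ecc_eigenvalue_def ecc_matrix_def G)

lemma xi2_block_chain:
  assumes "block_chain A B C D V (ecc_entry G)"
    and P: "P = real (card A) * real (card B)" and Q: "Q = real (card C) * real (card D)"
    and S: "S = 4 * P + 4 * Q + 9 * (real (card B) * real (card C))"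
  shows "\<xi> 2 G = sqrt ((S - sqrt (S\<^sup>2 - 64 * P * Q)) / 2)"
proof -
  interpret bc: block_chain A B C D V "ecc_entry G" by (rule assms)
  show ?thesis
    unfolding xi2_eq bc.second_eigenvalue[OF vertex_list] bc.P_def bc.Q_def bc.R_def
      S P Q ..
qed

text \<open>On the four vertices the kernel is invariant under the reversal \<open>a <-> e\<close>,
  \<open>b <-> c\<close>; its weight is \<open>p\<close> on the pair \<open>a, e\<close>,
  \<open>q\<close> on \<open>a, c\<close> and \<open>b, e\<close>, and \<open>r\<close> on
  \<open>a, b\<close> and \<open>c, e\<close>. A symmetric \<open>f\<close> and an antisymmetric
  \<open>g\<close> are then orthogonal in both senses required. The assumptions \<open>m\<close> are
  their Rayleigh inequalities divided by 2.\<close>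

lemma xi2_ge_four_points:
  assumes in4: "a \<in> V" "b \<in> V" "c \<in> V" "e \<in> V"
    and dist: "distinct [a, b, c, e]"
    and bil: "\<And>f g. bilin {a, b, c, e} (ecc_entry G) f g =
      p * (f a * g e + f e * g a) + q * (f a * g c + f c * g a + f b * g e + f e * g b) +
      r * (f a * g b + f b * g a + f c * g e + f e * g c)"
    and m: "m * (\<alpha>\<^sup>2 + \<beta>\<^sup>2) \<le> p * \<alpha>\<^sup>2 + 2 * q * \<alpha> * \<beta> + 2 * r * \<alpha> * \<beta>"
      "m * (\<gamma>\<^sup>2 + \<delta>\<^sup>2) \<le> - p * \<gamma>\<^sup>2 - 2 * q * \<gamma> * \<delta> + 2 * r * \<gamma> * \<delta>"
    and nz: "\<alpha> \<noteq> 0" "\<gamma> \<noteq> 0"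
  shows "m \<le> \<xi> 2 G"
proof -
  define f where "f x = (if x = a \<or> x = e then \<alpha> else if x = b \<or> x = c then \<beta> else 0)" for x
  define g where "g x = (if x = a then \<gamma> else if x = b then \<delta> else if x = c then -\<delta> else if x = e then -\<gamma> else 0)" for x
  have f: "f a = \<alpha>" "f e = \<alpha>" "f b = \<beta>" "f c = \<beta>" and g: "g a = \<gamma>" "g b = \<delta>" "g c = -\<delta>" "g e = -\<gamma>"
    using dist by (auto simp: f_def g_def)
  have f0: "f x = 0" and g0: "g x = 0" if "x \<notin> {a, b, c, e}" for x
    using that by (auto simp: f_def g_def)
  have sub4: "{a, b, c, e} \<subseteq> V" using in4 by simp
  have restr: "(\<Sum>x\<in>V. h x) = (\<Sum>x\<in>{a, b, c, e}. h x)" if "\<And>x. x \<notin> {a, b, c, e} \<Longrightarrow> h x = 0"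
    for h :: "'a \<Rightarrow> real"
    using that by (intro sum.mono_neutral_right[OF finV sub4]) blast
  have sum4: "(\<Sum>x\<in>{a, b, c, e}. h x) = h a + h b + h c + h e" for h :: "'a \<Rightarrow> real"
    using dist by simp
  have prod4: "(\<Sum>x\<in>V. h x * k x) = h a * k a + h b * k b + h c * k c + h e * k e"
    if "\<And>x. x \<notin> {a, b, c, e} \<Longrightarrow> h x = 0" for h k :: "'a \<Rightarrow> real"
  proof -
    have "(\<Sum>x\<in>V. h x * k x) = (\<Sum>x\<in>{a, b, c, e}. h x * k x)"
      by (rule restr) (simp add: that)
    then show ?thesis by (simp only: sum4)
  qed
  have bil4: "bilin V (ecc_entry G) h k = bilin {a, b, c, e} (ecc_entry G) h k"
    if "\<And>x. x \<notin> {a, b, c, e} \<Longrightarrow> h x = 0" "\<And>x. x \<notin> {a, b, c, e} \<Longrightarrow> k x = 0" for h k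
  proof -
    have "(\<Sum>y\<in>V. ecc_entry G x y * k y) = (\<Sum>y\<in>{a, b, c, e}. ecc_entry G x y * k y)" for x
      by (rule restr) (simp add: that(2))
    then show ?thesis
      unfolding bilin_def by (simp only:) (rule restr, simp add: that(1))
  qed
  have pf: "(\<Sum>x\<in>V. f x * k x) = f a * k a + f b * k b + f c * k c + f e * k e" for k
    by (rule prod4) (rule f0)
  have pg: "(\<Sum>x\<in>V. g x * k x) = g a * k a + g b * k b + g c * k c + g e * k e" for k
    by (rule prod4) (rule g0)
  have bff: "bilin V (ecc_entry G) f f = bilin {a, b, c, e} (ecc_entry G) f f"
    by (rule bil4; rule f0)
  have bgg: "bilin V (ecc_entry G) g g = bilin {a, b, c, e} (ecc_entry G) g g"
    by (rule bil4; rule g0)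
  have bfg: "bilin V (ecc_entry G) f g = bilin {a, b, c, e} (ecc_entry G) f g"
    by (rule bil4, rule f0, assumption, rule g0)
  have card: "2 \<le> card V"
    using card_mono[OF finV, of "{a, b}"] in4 dist by simp
  show ?thesis
    unfolding xi2_eq
  proof (rule second_eigenvalue_ge[OF vertex_list _ card, where f = f and g = g])
    show "(\<Sum>x\<in>V. f x * g x) = 0" by (simp add: pf f g)
    show "bilin V (ecc_entry G) f g = 0" unfolding bfg bil by (simp add: f g algebra_simps)
    have pos: "0 < x * x + y * y + y * y + x * x" if "x \<noteq> 0" for x y :: real
    proof -
      have "0 < x * x" using that zero_less_power2[of x] by (simp only: power2_eq_square) simp
      then show ?thesis using zero_le_square[of y] by linarith
    qed
    show "0 < (\<Sum>x\<in>V. f x * f x)" unfolding pf f by (rule pos[OF nz(1)])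
    show "0 < (\<Sum>x\<in>V. g x * g x)" unfolding pg g using pos[OF nz(2), of \<delta>] by simp
    have "m * (\<Sum>x\<in>V. f x * f x) = 2 * (m * (\<alpha>\<^sup>2 + \<beta>\<^sup>2))"
      unfolding pf f by (simp add: algebra_simps power2_eq_square)
    also have "\<dots> \<le> 2 * (p * \<alpha>\<^sup>2 + 2 * q * \<alpha> * \<beta> + 2 * r * \<alpha> * \<beta>)" using m(1) by simp
    also have "\<dots> = bilin V (ecc_entry G) f f"
      unfolding bff bil f by (simp add: algebra_simps power2_eq_square)
    finally show "m * (\<Sum>x\<in>V. f x * f x) \<le> bilin V (ecc_entry G) f f" .
    have "m * (\<Sum>x\<in>V. g x * g x) = 2 * (m * (\<gamma>\<^sup>2 + \<delta>\<^sup>2))"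
      unfolding pg g by (simp add: algebra_simps power2_eq_square)
    also have "\<dots> \<le> 2 * (- p * \<gamma>\<^sup>2 - 2 * q * \<gamma> * \<delta> + 2 * r * \<gamma> * \<delta>)" using m(2) by simp
    also have "\<dots> = bilin V (ecc_entry G) g g"
      unfolding bgg bil g by (simp add: algebra_simps power2_eq_square)
    finally show "m * (\<Sum>x\<in>V. g x * g x) \<le> bilin V (ecc_entry G) g g" .
  qed (rule ecc_entry_sym)
qed

end

end

section \<open>Complements, and trees of diameter at least 4\<close>

definition co_rel :: "'a set \<Rightarrow> 'a rel \<Rightarrow> 'a rel" where
  "co_rel V R = {(x, y). x \<in> V \<and> y \<in> V \<and> x \<noteq> y \<and> (x, y) \<notin> R}"

text \<open>Distinct vertices that are not adjacent in \<open>R\<close> are adjacent in the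
  complement, so only the edges of \<open>R\<close> have to be bridged.\<close>

lemma (in connected_rel) connected_co_rel:
  assumes "\<And>x y. x \<in> V \<Longrightarrow> y \<in> V \<Longrightarrow> (x, y) \<in> R \<Longrightarrow> (x, y) \<in> (co_rel V R)\<^sup>*"
  shows "connected_rel V (co_rel V R)"
proof
  show "(x, y) \<in> (co_rel V R)\<^sup>*" if "x \<in> V" "y \<in> V" for x y
    using assms that by (cases "x = y"; cases "(x, y) \<in> R") (auto simp: co_rel_def)
  show "(y, x) \<in> co_rel V R" if "(x, y) \<in> co_rel V R" for x y
    using that symR[of y x] by (auto simp: co_rel_def)
qed (use finV in \<open>auto simp: co_rel_def\<close>)

lemma graph_complement_simps [simp]:
  "pverts (graph_complement G) = pverts G"
  "parcs (graph_complement G) = co_rel (pverts G) (parcs G)"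
  by (simp_all add: graph_complement_def co_rel_def)

context tree_rel
begin

text \<open>Among the four vertices at the ends of the diametral path, only the distances
  \<open>D\<close> of \<open>a, e\<close> and \<open>D - 1\<close> of \<open>a, c\<close> and
  \<open>b, e\<close> reach the smaller eccentricity. In the complement all eccentricities are 2,
  and distance 2 means adjacency in \<open>G\<close>.\<close>

lemma long_diameter_xi2_ge:
  assumes G: "pverts G = V" "parcs G = R"
    and ab: "(a, b) \<in> R" and ce: "(c, e) \<in> R" and ae: "a \<noteq> e"
    and max: "\<And>x y. x \<in> V \<Longrightarrow> y \<in> V \<Longrightarrow> d x y \<le> d a e"
    and da: "\<And>w. w \<in> V \<Longrightarrow> w \<noteq> a \<Longrightarrow> d a w = Suc (d b w)"
    and de: "\<And>w. w \<in> V \<Longrightarrow> w \<noteq> e \<Longrightarrow> d e w = Suc (d c w)"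
    and long: "4 \<le> d a e"
  shows "8 / 5 \<le> \<xi> 2 G" "2 \<le> \<xi> 2 (graph_complement G)"
proof -
  define D where "D = d a e"
  have V: "a \<in> V" "b \<in> V" "c \<in> V" "e \<in> V" using inV[OF ab] inV[OF ce] by auto
  note sym = d_sym[OF V(1) V(2)] d_sym[OF V(1) V(3)] d_sym[OF V(1) V(4)]
    d_sym[OF V(2) V(3)] d_sym[OF V(2) V(4)] d_sym[OF V(3) V(4)]
  have D4: "4 \<le> D" using long by (simp add: D_def)
  have dab: "d a b = 1" "d c e = 1" using d_eq_1 V ab ce by auto
  have dae: "d a e = D" by (simp add: D_def)
  have dbe: "Suc (d b e) = D" using da[OF V(4)] ae dae by simp
  have dac: "Suc (d a c) = D" using de[OF V(1)] ae dae sym by simp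
  have "c \<noteq> a" using dac D4 by auto
  then have dbc: "Suc (Suc (d b c)) = D" using da[OF V(3)] dac by simp
  have dist: "distinct [a, b, c, e]"
    using dab dae dbe dac dbc D4 by auto
  have eca: "ec a = D" by (rule ec_eqI[OF _ V(4)]) (use max V in \<open>auto simp: dae\<close>)
  have ece: "ec e = D" by (rule ec_eqI[OF _ V(1)]) (use max V sym in \<open>auto simp: dae\<close>)
  have ecb: "ec b = D - 1"
  proof (rule ec_eqI[OF _ V(4)])
    show "d b e = D - 1" using dbe by simp
    show "d b w \<le> D - 1" if "w \<in> V" for w
    proof (cases "w = a")
      case True
      then show ?thesis using dab sym D4 by simp
    next
      case False
      then show ?thesis using da[OF that False] max[OF V(1) that] dae by simp
    qed
  qed
  have ecc: "ec c = D - 1"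
  proof (rule ec_eqI[OF _ V(1)])
    show "d c a = D - 1" using dac sym by simp
    show "d c w \<le> D - 1" if "w \<in> V" for w
    proof (cases "w = e")
      case True
      then show ?thesis using dab D4 by simp
    next
      case False
      then show ?thesis using de[OF that False] max[OF V(4) that] dae by simp
    qed
  qed
  have E: "ecc_entry G a e = D" "ecc_entry G a c = real D - 1" "ecc_entry G b e = real D - 1"
    "ecc_entry G a b = 0" "ecc_entry G b c = 0" "ecc_entry G c e = 0"
    "ecc_entry G e a = D" "ecc_entry G c a = real D - 1" "ecc_entry G e b = real D - 1"
    "ecc_entry G b a = 0" "ecc_entry G c b = 0" "ecc_entry G e c = 0"
    "ecc_entry G a a = 0" "ecc_entry G b b = 0" "ecc_entry G c c = 0" "ecc_entry G e e = 0"
    using dab dae dbe dac dbc D4 V sym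
    by (auto simp: ecc_entry_eq[OF G] eca ecb ecc ece)
  \<comment> \<open>The symmetric function has Rayleigh quotient \<open>(5 * D - 4) / 5\<close>, the
    antisymmetric one \<open>(3 * D - 4) / 5\<close>, which is exactly 8/5 for \<open>D = 4\<close>.
    The best antisymmetric choice there would give \<open>sqrt 13 - 2\<close>, only slightly
    more.\<close>
  show "8 / 5 \<le> \<xi> 2 G"
  proof (rule xi2_ge_four_points[OF G V dist, where p = "real D" and q = "real D - 1" and r = 0
        and \<alpha> = 1 and \<beta> = 2 and \<gamma> = 1 and \<delta> = "-2"])
    show "bilin {a, b, c, e} (ecc_entry G) f g = real D * (f a * g e + f e * g a) +
        (real D - 1) * (f a * g c + f c * g a + f b * g e + f e * g b) +
        0 * (f a * g b + f b * g a + f c * g e + f e * g c)" for f g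
      using dist by (simp add: bilin_def E algebra_simps)
  qed (use D4 in auto)

  \<comment> \<open>If every vertex were within distance 1 of an edge, the diameter would be at most
    3. A vertex away from the edge puts its two ends at distance 2 in the complement.\<close>
  have free: "\<exists>w\<in>V. w \<noteq> x \<and> w \<noteq> y \<and> (x, w) \<notin> R \<and> (w, y) \<notin> R" if xy: "(x, y) \<in> R" for x y
  proof (rule ccontr)
    assume *: "\<not> ?thesis"
    note xyV = inV[OF xy]
    have near: "\<exists>u\<in>{x, y}. d w u \<le> 1" if w: "w \<in> V" for w
    proof -
      consider "w = x" | "w = y" | "(w, x) \<in> R" | "(w, y) \<in> R" using * w symR by blast
      then show ?thesis
      proof cases
        case 3 then show ?thesis using d_eq_1[OF w xyV(1)] by simp
      next
        case 4 then show ?thesis using d_eq_1[OF w xyV(2)] by simp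
      qed simp_all
    qed
    obtain u where u: "u \<in> {x, y}" "d a u \<le> 1" using near[OF V(1)] by blast
    obtain v where v: "v \<in> {x, y}" "d e v \<le> 1" using near[OF V(4)] by blast
    have uvV: "u \<in> V" "v \<in> V" using u v xyV by auto
    have "d x y = 1" "d y x = 1" using d_eq_1 xyV xy symR by auto
    then have "d u v \<le> 1" using u(1) v(1) by auto
    moreover have "d a e \<le> d a u + d u e" using d_triangle V uvV by blast
    moreover have "d u e \<le> d u v + d v e" using d_triangle V uvV by blast
    moreover have "d v e = d e v" using d_sym V uvV by blast
    ultimately show False using u(2) v(2) long by linarith
  qed
  interpret co: connected_rel V "co_rel V R"
  proof (rule connected_co_rel)
    fix x y assume xy: "x \<in> V" "y \<in> V" "(x, y) \<in> R"
    obtain w where "w \<in> V" "w \<noteq> x" "w \<noteq> y" "(x, w) \<notin> R" "(w, y) \<notin> R"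
      using free[OF xy(3)] by blast
    then have "(x, w) \<in> co_rel V R" "(w, y) \<in> co_rel V R" using xy by (auto simp: co_rel_def)
    then show "(x, y) \<in> (co_rel V R)\<^sup>*" by (rule converse_rtrancl_into_rtrancl[OF _ r_into_rtrancl])
  qed
  have co1: "co.d x y = 1" if "x \<in> V" "y \<in> V" "x \<noteq> y" "(x, y) \<notin> R" for x y
    using co.d_eq_1[OF that(1,2)] that by (simp add: co_rel_def)
  have co2: "co.d x y = 2" if xy: "(x, y) \<in> R" for x y
  proof -
    obtain w where w: "w \<in> V" "w \<noteq> x" "w \<noteq> y" "(x, w) \<notin> R" "(w, y) \<notin> R"
      using free[OF xy] by blast
    have "x \<noteq> y" using xy irrefl by auto
    show ?thesis
      by (rule co.d_eq_2[of x y w]) (use w inV[OF xy] xy \<open>x \<noteq> y\<close> in \<open>auto simp: co_rel_def\<close>)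
  qed
  have co_ec: "co.ec x = 2" if x: "x \<in> V" for x
  proof -
    obtain y where y: "(x, y) \<in> R"
    proof -
      have "a \<noteq> b" using dist by simp
      then obtain z where z: "z \<in> V" "z \<noteq> x" using V by blast
      then have "d z x \<noteq> 0" using d_eq_0 x by blast
      then obtain k where "d z x = Suc k" using not0_implies_Suc by blast
      then show thesis using d_pred[OF z(1) x] symR that by blast
    qed
    show ?thesis
    proof (rule co.ec_eqI[OF _ inV(2)[OF y] co2[OF y]])
      show "co.d x w \<le> 2" if "w \<in> V" for w
        using co1[OF x that] co2[of x w] by (cases "x = w"; cases "(x, w) \<in> R") auto
    qed
  qed
  define H where "H = graph_complement G"
  have H: "pverts H = V" "parcs H = co_rel V R" by (simp_all add: H_def G)
  have co_entry: "ecc_entry H x y = (if (x, y) \<in> R then 2 else 0)" if "x \<in> V" "y \<in> V" for x y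
    using co1[OF that] co2[of x y] co_ec that
    by (cases "x = y"; cases "(x, y) \<in> R") (auto simp: co.ecc_entry_eq[OF H] irrefl)
  have nonadj: "(x, y) \<notin> R \<and> (y, x) \<notin> R" if "x \<in> V" "y \<in> V" "d x y \<noteq> 1" for x y
    using d_eq_1[OF that(1,2)] symR that(3) by blast
  have "(a, c) \<notin> R" "(c, a) \<notin> R" "(b, c) \<notin> R" "(c, b) \<notin> R" "(b, e) \<notin> R" "(e, b) \<notin> R"
    "(a, e) \<notin> R" "(e, a) \<notin> R"
    using nonadj[OF V(1,3)] nonadj[OF V(2,3)] nonadj[OF V(2,4)] nonadj[OF V(1,4)]
      dae dbe dac dbc D4 by auto
  then have E': "ecc_entry H a e = 0" "ecc_entry H a c = 0" "ecc_entry H b e = 0"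
    "ecc_entry H a b = 2" "ecc_entry H b c = 0" "ecc_entry H c e = 2"
    "ecc_entry H e a = 0" "ecc_entry H c a = 0" "ecc_entry H e b = 0"
    "ecc_entry H b a = 2" "ecc_entry H c b = 0" "ecc_entry H e c = 2"
    "ecc_entry H a a = 0" "ecc_entry H b b = 0" "ecc_entry H c c = 0" "ecc_entry H e e = 0"
    using V ab ce symR[OF ab] symR[OF ce] irrefl by (simp_all add: co_entry)
  \<comment> \<open>There is no edge between \<open>{a, b}\<close> and \<open>{c, e}\<close>. The
    sum and the difference of their indicator functions both have Rayleigh quotient 2 for twice the
    adjacency matrix.\<close>
  show "2 \<le> \<xi> 2 (graph_complement G)"
    unfolding H_def[symmetric]
  proof (rule co.xi2_ge_four_points[OF H V dist, where p = 0 and q = 0 and r = 2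
        and \<alpha> = 1 and \<beta> = 1 and \<gamma> = 1 and \<delta> = 1])
    show "bilin {a, b, c, e} (ecc_entry H) f g = 0 * (f a * g e + f e * g a) +
        0 * (f a * g c + f c * g a + f b * g e + f e * g b) +
        2 * (f a * g b + f b * g a + f c * g e + f e * g c)" for f g
      using dist by (simp add: bilin_def E' algebra_simps)
  qed auto
qed

end

section \<open>Double stars, the trees of diameter 3, and their complements\<close>

locale double_star = connected_rel +
  fixes b c :: 'a and A B :: "'a set"
  assumes V_eq: "V = {b, c} \<union> A \<union> B"
    and R_iff: "(x, y) \<in> R \<longleftrightarrow> x = b \<and> y = c \<or> x = c \<and> y = b \<or> x = b \<and> y \<in> A \<or> x \<in> A \<and> y = b \<or>
      x = c \<and> y \<in> B \<or> x \<in> B \<and> y = c"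
    and bc: "b \<noteq> c" and notin: "b \<notin> A" "b \<notin> B" "c \<notin> A" "c \<notin> B" and AB: "A \<inter> B = {}"
    and nonempty: "A \<noteq> {}" "B \<noteq> {}"
begin

lemma in_A: "x \<in> A \<Longrightarrow> x \<in> V \<and> x \<noteq> b \<and> x \<noteq> c \<and> x \<notin> B"
  using V_eq notin AB by auto

lemma in_B: "x \<in> B \<Longrightarrow> x \<in> V \<and> x \<noteq> b \<and> x \<noteq> c \<and> x \<notin> A"
  using V_eq notin AB by auto

lemma bcV: "b \<in> V" "c \<in> V"
  using V_eq by auto

lemma V_cases:
  assumes "x \<in> V"
  obtains "x = b" | "x = c" | "x \<in> A" | "x \<in> B"
  using assms V_eq by auto

lemma finAB: "finite A" "finite B"
  using finV V_eq by auto

lemma card_V: "card V = card A + card B + 2"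
proof -
  have "card ({b, c} \<union> (A \<union> B)) = card {b, c} + card (A \<union> B)"
    using finAB notin by (intro card_Un_disjoint) auto
  moreover have "card (A \<union> B) = card A + card B" using finAB AB by (intro card_Un_disjoint) auto
  ultimately show ?thesis using bc by (simp add: V_eq Un_assoc)
qed

text \<open>Centres have eccentricity 2 and leaves 3. What survives is distance 3 between leaves on
  opposite sides and distance 2 between a centre and the leaves of the other centre; this is why
  \<open>c\<close> is next to \<open>A\<close> in the chain.\<close>

lemma chain_tree:
  assumes G: "pverts G = V" "parcs G = R"
  shows "block_chain {c} A B {b} V (ecc_entry G)"
proof -
  note simps = R_iff bc bc[symmetric] notin
  obtain a0 where a0: "a0 \<in> A" using nonempty by blast
  obtain b0 where b0: "b0 \<in> B" using nonempty by blast
  have d1: "d x y = 1" if "x \<in> V" "y \<in> V" "(x, y) \<in> R" for x y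
    using d_eq_1[OF that(1,2)] that(3) by blast
  have dAB: "d x y = 3" if x: "x \<in> A" and y: "y \<in> B" for x y
    by (rule d_eq_3[of x y b c]) (use in_A[OF x] in_B[OF y] x y in \<open>auto simp: simps\<close>)
  have dAA: "d x y = 2" if x: "x \<in> A" and y: "y \<in> A" and "x \<noteq> y" for x y
    by (rule d_eq_2[of x y b]) (use in_A[OF x] in_A[OF y] that in \<open>auto simp: simps\<close>)
  have dBB: "d x y = 2" if x: "x \<in> B" and y: "y \<in> B" and "x \<noteq> y" for x y
    by (rule d_eq_2[of x y c]) (use in_B[OF x] in_B[OF y] that in \<open>auto simp: simps\<close>)
  have dAc: "d x c = 2" if x: "x \<in> A" for x
    by (rule d_eq_2[of x c b]) (use in_A[OF x] x bcV in \<open>auto simp: simps\<close>)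
  have dBb: "d x b = 2" if x: "x \<in> B" for x
    by (rule d_eq_2[of x b c]) (use in_B[OF x] x bcV in \<open>auto simp: simps\<close>)
  have dAb: "d x b = 1" if x: "x \<in> A" for x
    by (rule d1) (use in_A[OF x] x bcV in \<open>auto simp: simps\<close>)
  have dBc: "d x c = 1" if x: "x \<in> B" for x
    by (rule d1) (use in_B[OF x] x bcV in \<open>auto simp: simps\<close>)
  have dbc: "d b c = 1" by (rule d1) (use bcV in \<open>auto simp: simps\<close>)
  have dBA: "d x y = 3" if "x \<in> B" "y \<in> A" for x y
    using dAB[OF that(2,1)] d_sym in_A[OF that(2)] in_B[OF that(1)] by simp
  have dcA: "d c x = 2" "d b x = 1" if "x \<in> A" for x
    using dAc[OF that] dAb[OF that] d_sym in_A[OF that] bcV by simp_all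
  have dbB: "d b x = 2" "d c x = 1" if "x \<in> B" for x
    using dBb[OF that] dBc[OF that] d_sym in_B[OF that] bcV by simp_all
  have dcb: "d c b = 1" using dbc d_sym bcV by simp
  have ecA: "ec x = 3" if x: "x \<in> A" for x
  proof (rule ec_eqI[OF _ _ dAB[OF x b0]])
    show "d x w \<le> 3" if "w \<in> V" for w
      using that by (cases rule: V_cases; cases "x = w") (use x in \<open>auto simp: dAb dAc dAA dAB\<close>)
  qed (use in_B[OF b0] in blast)
  have ecB: "ec x = 3" if x: "x \<in> B" for x
  proof (rule ec_eqI[OF _ _ dBA[OF x a0]])
    show "d x w \<le> 3" if "w \<in> V" for w
      using that by (cases rule: V_cases; cases "x = w") (use x in \<open>auto simp: dBb dBc dBB dBA\<close>)
  qed (use in_A[OF a0] in blast)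
  have ecb: "ec b = 2"
  proof (rule ec_eqI[OF _ _ dbB(1)[OF b0]])
    show "d b w \<le> 2" if "w \<in> V" for w
      using that by (cases rule: V_cases) (auto simp: dbc dcA dbB)
  qed (use in_B[OF b0] in blast)
  have ecc: "ec c = 2"
  proof (rule ec_eqI[OF _ _ dcA(1)[OF a0]])
    show "d c w \<le> 2" if "w \<in> V" for w
      using that by (cases rule: V_cases) (auto simp: dcb dcA dbB)
  qed (use in_A[OF a0] in blast)
  show ?thesis
  proof
    show "V = {c} \<union> A \<union> B \<union> {b}" using V_eq by auto
    show "ecc_entry G x y = chain_kernel {c} A B {b} x y" if xy: "x \<in> V" "y \<in> V" for x y
      unfolding ecc_entry_eq[OF G xy] chain_kernel_def
    proof (cases "x = y")
      case True
      show "(if d x y = min (ec x) (ec y) then real (d x y) else 0) =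
        (if x \<in> {c} \<and> y \<in> A \<or> x \<in> A \<and> y \<in> {c} \<or> x \<in> B \<and> y \<in> {b} \<or> x \<in> {b} \<and> y \<in> B then 2
         else if x \<in> A \<and> y \<in> B \<or> x \<in> B \<and> y \<in> A then 3 else 0)"
        unfolding True using notin AB by auto
    next
      case False
      from xy(1) show "(if d x y = min (ec x) (ec y) then real (d x y) else 0) =
        (if x \<in> {c} \<and> y \<in> A \<or> x \<in> A \<and> y \<in> {c} \<or> x \<in> B \<and> y \<in> {b} \<or> x \<in> {b} \<and> y \<in> B then 2
         else if x \<in> A \<and> y \<in> B \<or> x \<in> B \<and> y \<in> A then 3 else 0)"
      proof (cases rule: V_cases)
        case 1
        from xy(2) show ?thesis
          by (cases rule: V_cases)
            (use False 1 in_A[of y] in_B[of y] in \<open>simp_all add: ecA ecB ecb ecc dbc dcA dbB bc notin\<close>)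
      next
        case 2
        from xy(2) show ?thesis
          by (cases rule: V_cases)
            (use False 2 in_A[of y] in_B[of y] in \<open>simp_all add: ecA ecB ecb ecc dcb dcA dbB bc[symmetric] notin\<close>)
      next
        case 3
        from xy(2) show ?thesis
          by (cases rule: V_cases)
            (use False 3 in_A[OF 3] in_A[of y] in_B[of y] in \<open>simp_all add: ecA ecB ecb ecc dAb dAc dAA dAB notin bc bc[symmetric]\<close>)
      next
        case 4
        from xy(2) show ?thesis
          by (cases rule: V_cases)
            (use False 4 in_B[OF 4] in_A[of y] in_B[of y] in \<open>simp_all add: ecA ecB ecb ecc dBb dBc dBB dBA notin bc bc[symmetric]\<close>)
      qed
    qed
  qed (use nonempty finV notin AB bc in auto)
qed

text \<open>In the complement the shortest way from \<open>b\<close> to \<open>c\<close> leads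
  through \<open>B\<close> and \<open>A\<close>, so it has length 3; a leaf is at distance 2 from
  its former centre, and all other distances between distinct vertices are 1. Eccentricities are 3
  for the centres and 2 for the leaves, so the distances 1 drop out.\<close>

lemma chain_complement:
  assumes G: "pverts G = V" "parcs G = co_rel V R"
  shows "block_chain A {b} {c} B V (ecc_entry G)"
    and "connected_rel V (co_rel V R)"
proof -
  note simps = co_rel_def R_iff bc bc[symmetric] notin
  obtain a0 where a0: "a0 \<in> A" using nonempty by blast
  obtain b0 where b0: "b0 \<in> B" using nonempty by blast
  have cRb: "(c, x) \<in> co_rel V R" "(x, c) \<in> co_rel V R" if "x \<in> A" for x
    using that in_A[OF that] bcV by (auto simp: simps)
  have bRc: "(b, x) \<in> co_rel V R" "(x, b) \<in> co_rel V R" if "x \<in> B" for x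
    using that in_B[OF that] bcV by (auto simp: simps)
  have ARB: "(x, y) \<in> co_rel V R" "(y, x) \<in> co_rel V R" if "x \<in> A" "y \<in> B" for x y
    using that in_A[OF that(1)] in_B[OF that(2)] by (auto simp: simps)
  have ARA: "(x, y) \<in> co_rel V R" if "x \<in> A" "y \<in> A" "x \<noteq> y" for x y
    using that in_A[OF that(1)] in_A[OF that(2)] by (auto simp: simps)
  have BRB: "(x, y) \<in> co_rel V R" if "x \<in> B" "y \<in> B" "x \<noteq> y" for x y
    using that in_B[OF that(1)] in_B[OF that(2)] by (auto simp: simps)
  have path: "(x, y) \<in> (co_rel V R)\<^sup>*" if "(x, u) \<in> co_rel V R" "(u, y) \<in> co_rel V R" for x u y
    by (rule converse_rtrancl_into_rtrancl[OF that(1) r_into_rtrancl[OF that(2)]])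
  have path3: "(x, y) \<in> (co_rel V R)\<^sup>*"
    if "(x, u) \<in> co_rel V R" "(u, w) \<in> co_rel V R" "(w, y) \<in> co_rel V R" for x u w y
    by (rule converse_rtrancl_into_rtrancl[OF that(1) path[OF that(2,3)]])
  show co: "connected_rel V (co_rel V R)"
  proof (rule connected_co_rel)
    fix x y assume "(x, y) \<in> R"
    then consider "x = b" "y = c" | "x = c" "y = b" | "x = b" "y \<in> A" | "x \<in> A" "y = b"
      | "x = c" "y \<in> B" | "x \<in> B" "y = c" unfolding R_iff by blast
    then show "(x, y) \<in> (co_rel V R)\<^sup>*"
    proof cases
      case 1 then show ?thesis using path3[OF bRc(1)[OF b0] ARB(2)[OF a0 b0] cRb(2)[OF a0]] by simp
    next
      case 2 then show ?thesis using path3[OF cRb(1)[OF a0] ARB(1)[OF a0 b0] bRc(2)[OF b0]] by simp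
    next
      case 3 then show ?thesis using path[OF bRc(1)[OF b0] ARB(2)[OF _ b0]] by simp
    next
      case 4 then show ?thesis using path[OF ARB(1)[OF _ b0] bRc(2)[OF b0]] by simp
    next
      case 5 then show ?thesis using path[OF cRb(1)[OF a0] ARB(1)[OF a0]] by simp
    next
      case 6 then show ?thesis using path[OF ARB(2)[OF a0] cRb(2)[OF a0]] by simp
    qed
  qed
  interpret co: connected_rel V "co_rel V R" by (rule co)
  have d1: "co.d x y = 1" if "(x, y) \<in> co_rel V R" for x y
    using co.d_eq_1[OF co.inV[OF that]] that by blast
  have dbc: "co.d b c = 3"
    by (rule co.d_eq_3[OF _ _ _ _ _ bRc(1)[OF b0] ARB(2)[OF a0 b0] cRb(2)[OF a0]])
      (use bcV in \<open>auto simp: simps elim!: V_cases\<close>)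
  have dAb: "co.d x b = 2" if x: "x \<in> A" for x
    by (rule co.d_eq_2[OF _ _ _ _ ARB(1)[OF x b0] bRc(2)[OF b0]])
      (use bcV in_A[OF x] x in \<open>auto simp: simps\<close>)
  have dBc: "co.d x c = 2" if x: "x \<in> B" for x
    by (rule co.d_eq_2[OF _ _ _ _ ARB(2)[OF a0 x] cRb(2)[OF a0]])
      (use bcV in_B[OF x] x in \<open>auto simp: simps\<close>)
  have dcb: "co.d c b = 3" using dbc co.d_sym bcV by simp
  have dbA: "co.d b x = 2" if "x \<in> A" for x
    using dAb[OF that] co.d_sym in_A[OF that] bcV by simp
  have dcB: "co.d c x = 2" if "x \<in> B" for x
    using dBc[OF that] co.d_sym in_B[OF that] bcV by simp
  note d1s = d1[OF cRb(1)] d1[OF cRb(2)] d1[OF bRc(1)] d1[OF bRc(2)] d1[OF ARB(1)] d1[OF ARB(2)]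
    d1[OF ARA] d1[OF BRB]
  have ecA: "co.ec x = 2" if x: "x \<in> A" for x
  proof (rule co.ec_eqI[OF _ bcV(1) dAb[OF x]])
    show "co.d x w \<le> 2" if "w \<in> V" for w
      using that by (cases rule: V_cases; cases "x = w") (use x in \<open>simp_all add: dAb d1s\<close>)
  qed
  have ecB: "co.ec x = 2" if x: "x \<in> B" for x
  proof (rule co.ec_eqI[OF _ bcV(2) dBc[OF x]])
    show "co.d x w \<le> 2" if "w \<in> V" for w
      using that by (cases rule: V_cases; cases "x = w") (use x in \<open>simp_all add: dBc d1s\<close>)
  qed
  have ecb: "co.ec b = 3"
  proof (rule co.ec_eqI[OF _ bcV(2) dbc])
    show "co.d b w \<le> 3" if "w \<in> V" for w
      using that by (cases rule: V_cases) (simp_all add: dbc dbA d1s)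
  qed
  have ecc: "co.ec c = 3"
  proof (rule co.ec_eqI[OF _ bcV(1) dcb])
    show "co.d c w \<le> 3" if "w \<in> V" for w
      using that by (cases rule: V_cases) (simp_all add: dcb dcB d1s)
  qed
  show "block_chain A {b} {c} B V (ecc_entry G)"
  proof
    show "V = A \<union> {b} \<union> {c} \<union> B" using V_eq by auto
    show "ecc_entry G x y = chain_kernel A {b} {c} B x y" if xy: "x \<in> V" "y \<in> V" for x y
      unfolding co.ecc_entry_eq[OF G xy] chain_kernel_def
    proof (cases "x = y")
      case True
      show "(if co.d x y = min (co.ec x) (co.ec y) then real (co.d x y) else 0) =
        (if x \<in> A \<and> y \<in> {b} \<or> x \<in> {b} \<and> y \<in> A \<or> x \<in> {c} \<and> y \<in> B \<or> x \<in> B \<and> y \<in> {c} then 2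
         else if x \<in> {b} \<and> y \<in> {c} \<or> x \<in> {c} \<and> y \<in> {b} then 3 else 0)"
        unfolding True using notin AB bc by auto
    next
      case False
      from xy(1) show "(if co.d x y = min (co.ec x) (co.ec y) then real (co.d x y) else 0) =
        (if x \<in> A \<and> y \<in> {b} \<or> x \<in> {b} \<and> y \<in> A \<or> x \<in> {c} \<and> y \<in> B \<or> x \<in> B \<and> y \<in> {c} then 2
         else if x \<in> {b} \<and> y \<in> {c} \<or> x \<in> {c} \<and> y \<in> {b} then 3 else 0)"
      proof (cases rule: V_cases)
        case 1
        from xy(2) show ?thesis
          by (cases rule: V_cases)
            (use False 1 in_A[of y] in_B[of y] in \<open>simp_all add: ecA ecB ecb ecc dbc dbA d1s bc notin\<close>)
      next
        case 2
        from xy(2) show ?thesis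
          by (cases rule: V_cases)
            (use False 2 in_A[of y] in_B[of y] in \<open>simp_all add: ecA ecB ecb ecc dcb dcB d1s bc[symmetric] notin\<close>)
      next
        case 3
        from xy(2) show ?thesis
          by (cases rule: V_cases)
            (use False 3 in_A[OF 3] in_A[of y] in_B[of y] in \<open>simp_all add: ecA ecB ecb ecc dAb d1s notin bc bc[symmetric]\<close>)
      next
        case 4
        from xy(2) show ?thesis
          by (cases rule: V_cases)
            (use False 4 in_B[OF 4] in_A[of y] in_B[of y] in \<open>simp_all add: ecA ecB ecb ecc dBc d1s notin bc bc[symmetric]\<close>)
      qed
    qed
  qed (use nonempty finV notin AB bc in auto)
qed

definition "pq = real (card A) * real (card B)"

text \<open>In both chains \<open>P\<close> and \<open>Q\<close> are the two leaf counts, with sum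
  \<open>n - 2\<close> and product \<open>pq\<close>. The middle product \<open>R\<close> is
  \<open>pq\<close> for the tree and 1 for the complement.\<close>

lemma xi2_double_star:
  assumes G: "pverts G = V" "parcs G = R" and n: "card V = n"
  shows "\<xi> 2 G = sqrt ((4 * real n - 8 + 9 * pq - sqrt ((4 * real n - 8 + 9 * pq)\<^sup>2 - 64 * pq)) / 2)"
    and "\<xi> 2 (graph_complement G) = sqrt ((4 * real n + 1 - sqrt ((4 * real n + 1)\<^sup>2 - 64 * pq)) / 2)"
proof -
  have n': "real n = real (card A) + real (card B) + 2" using card_V n by simp
  show "\<xi> 2 G = sqrt ((4 * real n - 8 + 9 * pq - sqrt ((4 * real n - 8 + 9 * pq)\<^sup>2 - 64 * pq)) / 2)"
    using xi2_block_chain[OF G chain_tree[OF G] refl refl refl] unfolding n' pq_def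
    by (simp add: algebra_simps)
  define H where "H = graph_complement G"
  have H: "pverts H = V" "parcs H = co_rel V R" by (simp_all add: H_def G)
  interpret co: connected_rel V "co_rel V R" by (rule chain_complement(2)[OF H])
  show "\<xi> 2 (graph_complement G) = sqrt ((4 * real n + 1 - sqrt ((4 * real n + 1)\<^sup>2 - 64 * pq)) / 2)"
    using co.xi2_block_chain[OF H chain_complement(1)[OF H] refl refl refl] unfolding n' pq_def H_def
    by (simp add: algebra_simps)
qed

end

section \<open>Comparison of the bounds\<close>

text \<open>The sign of the quadratic at \<open>t\<close> decides which of
  \<open>(S - 2 * t)^2\<close> and the discriminant is larger. As \<open>sqrt\<close> is strictly
  increasing on all reals, this comparison carries over to the square roots whatever the sign of the
  discriminant.\<close>

lemma smaller_root_less_iff: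
  fixes S K t :: real
  shows "t \<le> S / 2 \<Longrightarrow> t\<^sup>2 - S * t + K > 0 \<Longrightarrow> t < (S - sqrt (S\<^sup>2 - 4 * K)) / 2"
    and "t\<^sup>2 - S * t + K < 0 \<Longrightarrow> (S - sqrt (S\<^sup>2 - 4 * K)) / 2 < t"
proof -
  have sq: "(S - 2 * t)\<^sup>2 = S\<^sup>2 - 4 * K + 4 * (t\<^sup>2 - S * t + K)"
    by (simp add: algebra_simps power2_eq_square)
  show "t < (S - sqrt (S\<^sup>2 - 4 * K)) / 2" if t: "t \<le> S / 2" "t\<^sup>2 - S * t + K > 0"
  proof -
    have "sqrt (S\<^sup>2 - 4 * K) < S - 2 * t"
    proof -
      have "sqrt (S\<^sup>2 - 4 * K) < sqrt ((S - 2 * t)\<^sup>2)"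
        unfolding real_sqrt_less_iff sq using t(2) by simp
      then show ?thesis using t(1) by simp
    qed
    then show ?thesis by simp
  qed
  show "(S - sqrt (S\<^sup>2 - 4 * K)) / 2 < t" if t: "t\<^sup>2 - S * t + K < 0"
  proof -
    have "sqrt ((S - 2 * t)\<^sup>2) < sqrt (S\<^sup>2 - 4 * K)"
      unfolding real_sqrt_less_iff sq using t by simp
    then have "S - 2 * t < sqrt (S\<^sup>2 - 4 * K)" by simp
    then show ?thesis by simp
  qed
qed

lemma smaller_root_root:
  fixes S K :: real
  assumes "S\<^sup>2 - 4 * K \<ge> 0"
  defines "s \<equiv> (S - sqrt (S\<^sup>2 - 4 * K)) / 2"
  shows "s\<^sup>2 - S * s + K = 0" "s \<le> S / 2"
proof -
  have "(sqrt (S\<^sup>2 - 4 * K))\<^sup>2 = S\<^sup>2 - 4 * K" using assms(1) by simp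
  then show "s\<^sup>2 - S * s + K = 0" by (simp add: s_def field_simps power2_eq_square)
  show "s \<le> S / 2" using assms(1) by (simp add: s_def)
qed

text \<open>Here \<open>m\<close> stands for the product of the leaf counts of a double star;
  \<open>m = n - 3\<close> gives the first term of the claimed bound.\<close>

definition tree_bound :: "real \<Rightarrow> real \<Rightarrow> real" where
  "tree_bound n m = sqrt ((4 * n - 8 + 9 * m - sqrt ((4 * n - 8 + 9 * m)\<^sup>2 - 64 * m)) / 2)"

definition complement_bound :: "real \<Rightarrow> real \<Rightarrow> real" where
  "complement_bound n m = sqrt ((4 * n + 1 - sqrt ((4 * n + 1)\<^sup>2 - 64 * m)) / 2)"

text \<open>Let \<open>s\<close> be the smaller root for the product \<open>n - 3\<close>. Replacing
  the product by \<open>m\<close> changes the quadratic at \<open>s\<close> by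
  \<open>(m - (n - 3)) * (16 - 9 * s)\<close>; this is positive because \<open>s < 16 / 9\<close>,
  so the smaller root moves to the right.\<close>

lemma tree_bound_less:
  assumes n: "n \<ge> 4"
  shows "tree_bound n (n - 3) < 8 / 5" and "m > n - 3 \<Longrightarrow> tree_bound n (n - 3) < tree_bound n m"
proof -
  define S where "S = 13 * n - 35"
  define K where "K = 16 * (n - 3)"
  define s where "s = (S - sqrt (S\<^sup>2 - 4 * K)) / 2"
  \<comment> \<open>The value of the quadratic at 16/9, the point where \<open>16 - 9 * s\<close>
    changes sign. It also yields the bound 8/5, since \<open>4 / 3 < 8 / 5\<close>.\<close>
  define N where "N = (16 / 9)\<^sup>2 - S * (16 / 9) + K"
  have "N = (1408 - 576 * n) / 81" by (simp add: N_def S_def K_def field_simps power2_eq_square)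
  then have N: "N < 0" using n by simp
  then have neg: "(16 / 9)\<^sup>2 - S * (16 / 9) + K < 0" by (simp only: N_def)
  have s: "s < 16 / 9" unfolding s_def by (rule smaller_root_less_iff(2)[OF neg])
  have "(S - 32 / 9)\<^sup>2 = S\<^sup>2 - 4 * K + 4 * N"
    by (simp add: N_def field_simps power2_eq_square)
  then have disc: "S\<^sup>2 - 4 * K \<ge> 0" using N zero_le_power2[of "S - 32 / 9"] by linarith
  note root = smaller_root_root[OF disc, folded s_def]
  have eq: "tree_bound n (n - 3) = sqrt s"
    by (simp add: tree_bound_def s_def S_def K_def algebra_simps)
  have "sqrt s < sqrt ((8 / 5)\<^sup>2)" unfolding real_sqrt_less_iff using s by (simp add: power2_eq_square)
  then show "tree_bound n (n - 3) < 8 / 5" unfolding eq by simp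
  assume m: "m > n - 3"
  define S' where "S' = 4 * n - 8 + 9 * m"
  have "s\<^sup>2 - S' * s + 16 * m = (s\<^sup>2 - S * s + K) + (m - (n - 3)) * (16 - 9 * s)"
    by (simp add: S_def S'_def K_def algebra_simps)
  also have "\<dots> > 0" unfolding root(1) using m s by simp
  finally have "s\<^sup>2 - S' * s + 16 * m > 0" .
  moreover have "s \<le> S' / 2" using root(2) m by (simp add: S_def S'_def)
  ultimately have "s < (S' - sqrt (S'\<^sup>2 - 4 * (16 * m))) / 2"
    by (intro smaller_root_less_iff(1))
  then show "tree_bound n (n - 3) < tree_bound n m"
    unfolding eq tree_bound_def[of n m] real_sqrt_less_iff by (simp add: S'_def)
qed

text \<open>Here only the constant coefficient depends on the product, so a larger product lifts the
  quadratic and moves its smaller root to the right.\<close>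

lemma complement_bound_less:
  assumes n: "n \<ge> 4"
  shows "complement_bound n (n - 3) < 2"
    and "m > n - 3 \<Longrightarrow> complement_bound n (n - 3) < complement_bound n m"
proof -
  define S where "S = 4 * n + 1"
  define K where "K = 16 * (n - 3)"
  define s where "s = (S - sqrt (S\<^sup>2 - 4 * K)) / 2"
  \<comment> \<open>The value at 4 is -36 for every \<open>n\<close>, so 4 lies strictly between the
    roots.\<close>
  have neg: "4\<^sup>2 - S * 4 + K < 0" by (simp add: S_def K_def)
  have s: "s < 4" unfolding s_def by (rule smaller_root_less_iff(2)[OF neg])
  have "S\<^sup>2 - 4 * K = (4 * n - 7)\<^sup>2 + 144" by (simp add: S_def K_def algebra_simps power2_eq_square)
  then have disc: "S\<^sup>2 - 4 * K \<ge> 0" by simp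
  note root = smaller_root_root[OF disc, folded s_def]
  have eq: "complement_bound n (n - 3) = sqrt s"
    by (simp add: complement_bound_def s_def S_def K_def algebra_simps)
  have "sqrt s < sqrt (2\<^sup>2)" unfolding real_sqrt_less_iff using s by simp
  then show "complement_bound n (n - 3) < 2" unfolding eq by simp
  assume m: "m > n - 3"
  have "s\<^sup>2 - S * s + 16 * m = (s\<^sup>2 - S * s + K) + 16 * (m - (n - 3))"
    by (simp add: K_def algebra_simps)
  also have "\<dots> > 0" unfolding root(1) using m by simp
  finally have "s < (S - sqrt (S\<^sup>2 - 4 * (16 * m))) / 2"
    using root(2) by (intro smaller_root_less_iff(1))
  then show "complement_bound n (n - 3) < complement_bound n m"
    unfolding eq complement_bound_def[of n m] real_sqrt_less_iff by (simp add: S_def)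
qed

section \<open>Classification of trees by their diameter\<close>

lemma (in tree_rel) tree_shape:
  assumes card: "4 \<le> card V"
  obtains (star) b where "b \<in> V" "R = {b} \<times> (V - {b}) \<union> (V - {b}) \<times> {b}"
  | (double_star) b c A B where "double_star V R b c A B"
  | (long) a b c e where "(a, b) \<in> R" "(c, e) \<in> R" "a \<noteq> e"
    "\<And>x y. x \<in> V \<Longrightarrow> y \<in> V \<Longrightarrow> d x y \<le> d a e"
    "\<And>w. w \<in> V \<Longrightarrow> w \<noteq> a \<Longrightarrow> d a w = Suc (d b w)"
    "\<And>w. w \<in> V \<Longrightarrow> w \<noteq> e \<Longrightarrow> d e w = Suc (d c w)" "4 \<le> d a e"
proof -
  have "2 \<le> card V" using card by simp
  then obtain a b c e where ab: "(a, b) \<in> R" and ce: "(c, e) \<in> R" and ae: "a \<noteq> e" and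
    max: "\<And>x y. x \<in> V \<Longrightarrow> y \<in> V \<Longrightarrow> d x y \<le> d a e" and
    da: "\<And>w. w \<in> V \<Longrightarrow> w \<noteq> a \<Longrightarrow> d a w = Suc (d b w)" and
    de: "\<And>w. w \<in> V \<Longrightarrow> w \<noteq> e \<Longrightarrow> d e w = Suc (d c w)"
    by (rule diametral_path) blast
  have V: "a \<in> V" "b \<in> V" "c \<in> V" "e \<in> V" using inV[OF ab] inV[OF ce] by auto
  have dba: "d b a = 1" using d_eq_1[OF V(2,1)] symR[OF ab] by blast
  have dce: "d c e = 1" using d_eq_1[OF V(3,4)] ce by blast
  have "d a e \<noteq> 0" using d_eq_0[OF V(1,4)] ae by blast
  then consider "d a e = 1" | "d a e = 2" | "d a e = 3" | "4 \<le> d a e" by linarith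
  then show thesis
  proof cases
    case 1
    have "V \<subseteq> {a, b}"
    proof
      fix w assume w: "w \<in> V"
      show "w \<in> {a, b}"
      proof (cases "w = a")
        case False
        then have "d b w = 0" using da[OF w] max[OF V(1) w] 1 by simp
        then show ?thesis using d_eq_0[OF V(2) w] by simp
      qed simp
    qed
    then have "card V \<le> card {a, b}" by (intro card_mono) simp_all
    also have "card {a, b} \<le> 2" by (simp add: card_insert_if)
    finally show thesis using card by simp
  next
    \<comment> \<open>The vertex \<open>b\<close> is within distance 1 of every vertex, and an edge
      avoiding \<open>b\<close> would lie inside its first level.\<close>
    case 2
    have adj: "(b, w) \<in> R" if w: "w \<in> V" "w \<noteq> b" for w
    proof -
      have "d b w \<le> 1"
        using da[OF w(1)] max[OF V(1) w(1)] 2 dba by (cases "w = a") auto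
      moreover have "d b w \<noteq> 0" using d_eq_0[OF V(2) w(1)] w(2) by blast
      ultimately have "d b w = 1" by simp
      then show ?thesis using d_eq_1[OF V(2) w(1)] by blast
    qed
    have only: "x = b \<or> y = b" if xy: "(x, y) \<in> R" for x y
    proof (rule ccontr)
      assume "\<not> (x = b \<or> y = b)"
      then have "d b x = 1" "d b y = 1" using adj d_eq_1 V inV[OF xy] by blast+
      then show False using d_adjacent_neq[OF V(2) xy] by simp
    qed
    have "R = {b} \<times> (V - {b}) \<union> (V - {b}) \<times> {b}"
    proof (intro equalityI subsetI)
      fix p assume p: "p \<in> R"
      obtain x y where xy: "p = (x, y)" by (cases p)
      have "x \<noteq> y" using p xy irrefl by blast
      then show "p \<in> {b} \<times> (V - {b}) \<union> (V - {b}) \<times> {b}"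
        using only[of x y] inV[of x y] p xy by auto
    next
      fix p assume "p \<in> {b} \<times> (V - {b}) \<union> (V - {b}) \<times> {b}"
      then show "p \<in> R" using adj symR by blast
    qed
    then show thesis by (rule star[OF V(2)])
  next
    case 3
    have dca: "d c a = 2" using de[OF V(1)] ae d_sym[OF V(1,4)] 3 by simp
    have "c \<noteq> a" using dca by auto
    then have "d b c = 1" using da[OF V(3)] d_sym[OF V(1,3)] dca by simp
    then have bcR: "(b, c) \<in> R" using d_eq_1[OF V(2,3)] by blast
    have dbe: "d b e = 2" using da[OF V(4)] ae 3 by simp
    have db: "d b w \<le> 2" if "w \<in> V" for w
      using da[OF that] max[OF V(1) that] 3 dba by (cases "w = a") auto
    have dc: "d c w \<le> 2" if "w \<in> V" for w
      using de[OF that] max[OF V(4) that] 3 dce by (cases "w = e") auto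
    define A where "A = {x. (b, x) \<in> R \<and> x \<noteq> c}"
    define B where "B = {x. (c, x) \<in> R \<and> x \<noteq> b}"
    have A: "x \<in> A \<longleftrightarrow> (b, x) \<in> R \<and> x \<noteq> c" and B: "x \<in> B \<longleftrightarrow> (c, x) \<in> R \<and> x \<noteq> b" for x
      by (simp_all add: A_def B_def)
    have AV: "x \<in> V" "d b x = 1" if "x \<in> A" for x
      using that inV(2) d_eq_1[OF V(2)] unfolding A by blast+
    have BV: "x \<in> V" "d c x = 1" if "x \<in> B" for x
      using that inV(2) d_eq_1[OF V(3)] unfolding B by blast+
    have AB: "A \<inter> B = {}"
    proof (rule ccontr)
      assume "A \<inter> B \<noteq> {}"
      then obtain x where x: "x \<in> A" "x \<in> B" by blast
      then have "d x b = d x c" using AV BV d_sym V by metis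
      then show False using d_adjacent_neq[OF AV(1)[OF x(1)] bcR] by simp
    qed
    have neq: "b \<noteq> c" using bcR irrefl by blast
    \<comment> \<open>Seen from \<open>x\<close>, the adjacent vertices \<open>b\<close> and
      \<open>c\<close> lie on different levels, each of which is 1 or 2. So \<open>x\<close> is
      adjacent to one of them.\<close>
    have split: "x \<in> A \<or> x \<in> B" if x: "x \<in> V" "x \<noteq> b" "x \<noteq> c" for x
    proof -
      have "d b x \<noteq> d c x"
        using d_adjacent_neq[OF x(1) bcR] d_sym[OF x(1)] V by simp
      moreover have "d b x \<noteq> 0" "d c x \<noteq> 0" using d_eq_0 V x by blast+
      ultimately have "d b x = 1 \<or> d c x = 1" using db[OF x(1)] dc[OF x(1)] by linarith
      then show ?thesis using d_eq_1 V x unfolding A B by blast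
    qed
    have dbB: "d b x = 2" if x: "x \<in> B" for x
    proof -
      have xV: "x \<in> V" by (rule BV(1)[OF x])
      have "x \<notin> A" using AB x by blast
      then have "d b x \<noteq> 1" using d_eq_1[OF V(2) xV] x irrefl unfolding A B by blast
      moreover have "d b x \<noteq> 0" using d_eq_0[OF V(2) xV] x unfolding B by blast
      ultimately show ?thesis using db[OF xV] by linarith
    qed
    have noAA: "(x, y) \<notin> R" if "x \<in> A" "y \<in> A" for x y
      using d_adjacent_neq[OF V(2), of x y] AV that by metis
    have noBB: "(x, y) \<notin> R" if "x \<in> B" "y \<in> B" for x y
      using d_adjacent_neq[OF V(3), of x y] BV that by metis
    \<comment> \<open>Seen from \<open>b\<close>, the vertex \<open>y\<close> on level 2 would have
      two parents, \<open>x\<close> and \<open>c\<close>.\<close>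
    have noAB: "(x, y) \<notin> R" if x: "x \<in> A" and y: "y \<in> B" for x y
    proof
      assume xy: "(x, y) \<in> R"
      have cy: "(c, y) \<in> R" using y unfolding B by blast
      have "x = c"
        using parent_unique[OF V(2) xy cy] dbB[OF y] AV(2)[OF x] \<open>d b c = 1\<close> by simp
      then show False using x unfolding A by blast
    qed
    have "double_star V R b c A B"
    proof
      show "b \<noteq> c" by (rule neq)
      show "b \<notin> A" "c \<notin> A" "b \<notin> B" "c \<notin> B" using irrefl unfolding A B by blast+
      show "A \<inter> B = {}" by (rule AB)
      have "a \<in> A" using symR[OF ab] \<open>c \<noteq> a\<close> unfolding A by blast
      then show "A \<noteq> {}" by blast
      have "b \<noteq> e" using dbe by auto
      then have "e \<in> B" using ce unfolding B by blast
      then show "B \<noteq> {}" by blast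
      show "V = {b, c} \<union> A \<union> B" using split AV(1) BV(1) V by blast
      show "(x, y) \<in> R \<longleftrightarrow> x = b \<and> y = c \<or> x = c \<and> y = b \<or> x = b \<and> y \<in> A \<or> x \<in> A \<and> y = b \<or>
        x = c \<and> y \<in> B \<or> x \<in> B \<and> y = c" (is "_ \<longleftrightarrow> ?adj") for x y
      proof
        assume ?adj
        then show "(x, y) \<in> R" using bcR symR unfolding A B by blast
      next
        assume xy: "(x, y) \<in> R"
        note xyV = inV[OF xy]
        show ?adj
        proof (cases "x = b \<or> x = c")
          case True
          then show ?thesis using xy irrefl unfolding A B by blast
        next
          case False
          show ?thesis
          proof (cases "y = b \<or> y = c")
            case True
            then show ?thesis using symR[OF xy] False unfolding A B by blast
          next
            case y: False
            have "x \<in> A \<or> x \<in> B" "y \<in> A \<or> y \<in> B" using split xyV False y by blast+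
            then show ?thesis using noAA noBB noAB[of x y] noAB[of y x] xy symR[OF xy] by blast
          qed
        qed
      qed
    qed
    then show thesis by (rule double_star)
  next
    case 4
    show thesis by (rule long[OF ab ce ae max da de 4])
  qed
qed

section \<open>The extremal tree as a double star\<close>

lemma path_pendant_tree_arcs:
  assumes "4 \<le> n"
  shows "(i, j) \<in> parcs (path_pendant_tree n) \<longleftrightarrow> i = 0 \<and> j = 1 \<or> i = 1 \<and> j = 0 \<or>
    i = 1 \<and> j = 2 \<or> i = 2 \<and> j = 1 \<or> i = 2 \<and> 3 \<le> j \<and> j < n \<or> 3 \<le> i \<and> i < n \<and> j = 2"
proof -
  have symcl: "(i, j) \<in> S\<^sup>s \<longleftrightarrow> (i, j) \<in> S \<or> (j, i) \<in> S" for S :: "nat rel"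
    unfolding symcl_def by force
  have "(i, j) \<in> parcs (path_pendant_tree n) \<longleftrightarrow>
      (i = 0 \<and> j = 1 \<or> i = 1 \<and> j = 2 \<or> i = 2 \<and> j = 3 \<or> i = 2 \<and> 4 \<le> j \<and> j < n) \<or>
      (j = 0 \<and> i = 1 \<or> j = 1 \<and> i = 2 \<or> j = 2 \<and> i = 3 \<or> j = 2 \<and> 4 \<le> i \<and> i < n)"
    unfolding path_pendant_tree_def pair_pre_digraph.simps symcl by simp
  also have "\<dots> \<longleftrightarrow> i = 0 \<and> j = 1 \<or> i = 1 \<and> j = 0 \<or>
    i = 1 \<and> j = 2 \<or> i = 2 \<and> j = 1 \<or> i = 2 \<and> 3 \<le> j \<and> j < n \<or> 3 \<le> i \<and> i < n \<and> j = 2"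
    using assms by presburger
  finally show ?thesis .
qed

text \<open>The end 3 of the path is just another leaf at 2, so the target is a double star with
  centres 1 and 2, the single leaf 0 at 1 and the leaves \<open>3, ..., n - 1\<close> at 2. Any
  numbering \<open>g\<close> of \<open>B\<close> will do.\<close>

lemma (in double_star) iso_path_pendant_tree:
  assumes G: "pverts G = V" "parcs G = R" and n: "card V = n" and A1: "card A = 1"
  shows "digraph_iso (with_proj G) (with_proj (path_pendant_tree n))"
proof -
  obtain a where a: "A = {a}" using A1 by (rule card_1_singletonE)
  have "card B > 0" using nonempty finAB by (simp add: card_gt_0_iff)
  then have n4: "4 \<le> n" and cB: "card B = card {3..<n}" using card_V n A1 by simp_all
  obtain g where g: "bij_betw g B {3..<n}"
    using finite_same_card_bij[OF finAB(2) _ cB] by auto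
  define f where "f x = (if x = a then 0 else if x = b then 1 else if x = c then 2 else g x)" for x
  have aV: "a \<in> V" "a \<noteq> b" "a \<noteq> c" "a \<notin> B" using in_A[of a] a by auto
  have f: "f a = 0" "f b = 1" "f c = 2" using aV bc by (auto simp: f_def)
  have fB: "f x = g x" if "x \<in> B" for x using in_B[OF that] a by (auto simp: f_def)
  have gB: "3 \<le> g x \<and> g x < n" if "x \<in> B" for x using bij_betwE[OF g] that by auto
  have gsurj: "\<exists>x\<in>B. g x = i" if "3 \<le> i" "i < n" for i
    using bij_betw_imp_surj_on[OF g] that by (metis atLeastLessThan_iff imageE)
  have V4: "V = {a, b, c} \<union> B" using V_eq a by auto
  have inj: "inj_on f V"
  proof (rule inj_onI)
    fix x y assume xy: "x \<in> V" "y \<in> V" "f x = f y"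
    have gi: "x \<in> B \<Longrightarrow> y \<in> B \<Longrightarrow> g x = g y \<Longrightarrow> x = y"
      using bij_betw_imp_inj_on[OF g] by (rule inj_onD)
    have "x \<in> B \<or> x = a \<or> x = b \<or> x = c" "y \<in> B \<or> y = a \<or> y = b \<or> y = c" using xy V4 by auto
    then show "x = y" using xy(3) gi f fB[of x] fB[of y] gB[of x] gB[of y] by auto
  qed
  have img: "f ` V = {0..<n}"
  proof
    show "f ` V \<subseteq> {0..<n}" using f fB gB n4 by (auto simp: V4)
    show "{0..<n} \<subseteq> f ` V"
    proof
      fix i assume i: "i \<in> {0..<n}"
      consider "i = 0" | "i = 1" | "i = 2" | "3 \<le> i" by linarith
      then show "i \<in> f ` V"
      proof cases
        case 4
        then obtain x where "x \<in> B" "g x = i" using gsurj i by auto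
        then show ?thesis using fB V4 by (intro image_eqI[of _ _ x]) auto
      qed (use f V4 in \<open>force+\<close>)
    qed
  qed
  \<comment> \<open>Since \<open>with_proj\<close> makes the projections the tail and head maps, the
    arcs have to be mapped componentwise.\<close>
  define h where "h = \<lparr>iso_verts = f, iso_arcs = (\<lambda>(x, y). (f x, f y)), iso_head = snd, iso_tail = fst\<rparr>"
  have arcs: "(\<lambda>(x, y). (f x, f y)) ` R = parcs (path_pendant_tree n)"
  proof (intro equalityI subsetI)
    fix p assume "p \<in> (\<lambda>(x, y). (f x, f y)) ` R"
    then obtain x y where xy: "(x, y) \<in> R" and p: "p = (f x, f y)" by auto
    from xy consider "x = b" "y = c" | "x = c" "y = b" | "x = b" "y = a" | "x = a" "y = b"
      | "x = c" "y \<in> B" | "x \<in> B" "y = c" unfolding R_iff a by blast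
    then show "p \<in> parcs (path_pendant_tree n)"
      unfolding p path_pendant_tree_arcs[OF n4]
      by cases (use f fB gB in auto)
  next
    fix p assume "p \<in> parcs (path_pendant_tree n)"
    moreover obtain i j where p: "p = (i, j)" by (cases p)
    ultimately consider "i = 0" "j = 1" | "i = 1" "j = 0" | "i = 1" "j = 2" | "i = 2" "j = 1"
      | "i = 2" "3 \<le> j" "j < n" | "3 \<le> i" "i < n" "j = 2"
      using path_pendant_tree_arcs[OF n4, of i j] by blast
    then have "\<exists>x y. (x, y) \<in> R \<and> f x = i \<and> f y = j"
    proof cases
      case 1 then show ?thesis using f by (intro exI[of _ a] exI[of _ b]) (simp add: R_iff a)
    next
      case 2 then show ?thesis using f by (intro exI[of _ b] exI[of _ a]) (simp add: R_iff a)
    next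
      case 3 then show ?thesis using f by (intro exI[of _ b] exI[of _ c]) (simp add: R_iff)
    next
      case 4 then show ?thesis using f by (intro exI[of _ c] exI[of _ b]) (simp add: R_iff)
    next
      case 5
      then obtain x where "x \<in> B" "g x = j" using gsurj by blast
      then show ?thesis using 5 f fB by (intro exI[of _ c] exI[of _ x]) (simp add: R_iff)
    next
      case 6
      then obtain x where "x \<in> B" "g x = i" using gsurj by blast
      then show ?thesis using 6 f fB by (intro exI[of _ x] exI[of _ c]) (simp add: R_iff)
    qed
    then show "p \<in> (\<lambda>(x, y). (f x, f y)) ` R" unfolding p by force
  qed
  have "wf_digraph (with_proj G)"
    unfolding wf_digraph_wp_iff using inV by unfold_locales (auto simp: G)
  moreover have "inj_on (\<lambda>(x, y). (f x, f y)) R"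
    using inj inV by (auto simp: inj_on_def)
  ultimately have "pre_digraph.digraph_isomorphism (with_proj G) h"
    using inj by (auto simp: pre_digraph.digraph_isomorphism_def h_def G)
  moreover have "with_proj (path_pendant_tree n) = app_iso h (with_proj G)"
    using arcs img by (simp add: app_iso_def h_def G with_proj_def path_pendant_tree_def)
  ultimately show ?thesis unfolding digraph_iso_def by blast
qed

text \<open>The labels 0, 1, 2 and the range from 3 on are pulled back along the isomorphism to the
  leaf \<open>a\<close>, the centres \<open>b\<close> and \<open>c\<close>, and the block
  \<open>B\<close>.\<close>

lemma (in connected_rel) double_star_of_iso:
  assumes G: "pverts G = V" "parcs G = R" and n: "4 \<le> n"
    and iso: "digraph_iso (with_proj G) (with_proj (path_pendant_tree n))"
  obtains b c A B where "double_star V R b c A B" "card A = 1"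
proof -
  define P where "P = parcs (path_pendant_tree n)"
  obtain h where h: "pre_digraph.digraph_isomorphism (with_proj G) h"
    and eq: "with_proj (path_pendant_tree n) = app_iso h (with_proj G)"
    using iso unfolding digraph_iso_def by blast
  define f where "f = iso_verts h"
  have inj: "inj_on f V"
    using h by (simp add: pre_digraph.digraph_isomorphism_def f_def G)
  have img: "f ` V = {0..<n}"
    using arg_cong[OF eq, of verts] by (simp add: path_pendant_tree_def f_def G)
  have arcs: "iso_arcs h ` R = P" using arg_cong[OF eq, of arcs] by (simp add: P_def G)
  have ht: "iso_tail h = fst" "iso_head h = snd"
    using arg_cong[OF eq, of tail] arg_cong[OF eq, of head] by simp_all
  \<comment> \<open>The image has the projections as tail and head maps, which forces the arc map to
    act componentwise.\<close>
  have arc: "iso_arcs h (x, y) = (f x, f y)" if "(x, y) \<in> R" for x y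
  proof -
    have "f x = fst (iso_arcs h (x, y))" "f y = snd (iso_arcs h (x, y))"
      using h that by (auto simp: pre_digraph.digraph_isomorphism_def f_def G ht)
    then show ?thesis by simp
  qed
  have R_f: "(x, y) \<in> R \<longleftrightarrow> (f x, f y) \<in> P" if xy: "x \<in> V" "y \<in> V" for x y
  proof
    assume "(x, y) \<in> R"
    then show "(f x, f y) \<in> P" using arc arcs by force
  next
    assume "(f x, f y) \<in> P"
    then obtain x' y' where x'y': "(x', y') \<in> R" "(f x, f y) = iso_arcs h (x', y')"
      using arcs by (metis (no_types, lifting) imageE surj_pair)
    then have "f x = f x'" "f y = f y'" using arc by simp_all
    then have "x = x'" "y = y'" using inj_onD[OF inj] xy inV[OF x'y'(1)] by simp_all
    then show "(x, y) \<in> R" using x'y' by simp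
  qed
  have pre: "\<exists>x\<in>V. f x = i" if "i < n" for i
    using img that by (metis atLeastLessThan_iff imageE le0)
  obtain a where a: "a \<in> V" "f a = 0" using pre[of 0] n by auto
  obtain b where b: "b \<in> V" "f b = 1" using pre[of 1] n by auto
  obtain c where c: "c \<in> V" "f c = 2" using pre[of 2] n by auto
  obtain e where e: "e \<in> V" "f e = 3" using pre[of 3] n by auto
  define B where "B = {x \<in> V. 3 \<le> f x}"
  have fn: "f x < n" if "x \<in> V" for x using img that by auto
  have is_a: "f x = 0 \<longleftrightarrow> x = a" and is_b: "f x = 1 \<longleftrightarrow> x = b" and is_c: "f x = 2 \<longleftrightarrow> x = c"
    and is_B: "3 \<le> f x \<longleftrightarrow> x \<in> B" if "x \<in> V" for x
    using inj_onD[OF inj _ that] a b c that by (auto simp: B_def)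
  have "double_star V R b c {a} B"
  proof
    show "b \<noteq> c" "b \<notin> {a}" "c \<notin> {a}" using a b c by auto
    show "b \<notin> B" "c \<notin> B" "{a} \<inter> B = {}" using a b c by (auto simp: B_def)
    show "{a} \<noteq> {}" by simp
    show "B \<noteq> {}" using e by (auto simp: B_def)
    show "V = {b, c} \<union> {a} \<union> B"
    proof (intro equalityI subsetI)
      fix x assume x: "x \<in> V"
      consider "f x = 0" | "f x = 1" | "f x = 2" | "3 \<le> f x" by linarith
      then show "x \<in> {b, c} \<union> {a} \<union> B"
        using is_a[OF x] is_b[OF x] is_c[OF x] is_B[OF x] by cases auto
    next
      fix x assume "x \<in> {b, c} \<union> {a} \<union> B"
      then show "x \<in> V" using a b c by (auto simp: B_def)
    qed
    show "(x, y) \<in> R \<longleftrightarrow> x = b \<and> y = c \<or> x = c \<and> y = b \<or> x = b \<and> y \<in> {a} \<or> x \<in> {a} \<and> y = b \<or>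
        x = c \<and> y \<in> B \<or> x \<in> B \<and> y = c" for x y
    proof (cases "x \<in> V \<and> y \<in> V")
      case True
      then have xy: "x \<in> V" "y \<in> V" by auto
      show ?thesis
        unfolding R_f[OF xy] P_def path_pendant_tree_arcs[OF n] is_a[OF xy(1)] is_a[OF xy(2)]
          is_b[OF xy(1)] is_b[OF xy(2)] is_c[OF xy(1)] is_c[OF xy(2)] is_B[OF xy(1)] is_B[OF xy(2)]
        using fn[OF xy(1)] fn[OF xy(2)] by blast
    next
      case False
      then show ?thesis using inV[of x y] a b c by (auto simp: B_def)
    qed
  qed
  then show thesis by (rule that) simp
qed

section \<open>Minimising the product of the leaf counts, and the equality case\<close>

lemma (in double_star) swap: "double_star V R c b B A"
proof (intro double_star.intro connected_rel_axioms double_star_axioms.intro)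
  show "V = {c, b} \<union> B \<union> A" unfolding V_eq by blast
  show "(x, y) \<in> R \<longleftrightarrow> x = c \<and> y = b \<or> x = b \<and> y = c \<or> x = c \<and> y \<in> B \<or> x \<in> B \<and> y = c \<or>
      x = b \<and> y \<in> A \<or> x \<in> A \<and> y = b" for x y
    unfolding R_iff by (simp only: disj_ac)
  show "B \<inter> A = {}" by (rule trans[OF Int_commute AB])
  show "c \<noteq> b" by (rule bc[symmetric])
qed (rule notin nonempty)+

text \<open>The leaf counts are positive and add up to \<open>n - 2\<close>, so the excess of
  \<open>pq\<close> over \<open>n - 3\<close> is \<open>(card A - 1) * (card B - 1)\<close>.\<close>

lemma (in double_star) pq_bound:
  assumes "card V = n"
  shows "real n - 3 \<le> pq" and "pq = real n - 3 \<longleftrightarrow> card A = 1 \<or> card B = 1"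
proof -
  have "card A > 0" "card B > 0" using nonempty finAB by (simp_all add: card_gt_0_iff)
  then have ge: "1 \<le> real (card A)" "1 \<le> real (card B)" by simp_all
  have eq: "pq = real n - 3 + (real (card A) - 1) * (real (card B) - 1)"
    using card_V assms by (simp add: pq_def algebra_simps)
  show "real n - 3 \<le> pq" unfolding eq using ge by simp
  show "pq = real n - 3 \<longleftrightarrow> card A = 1 \<or> card B = 1" unfolding eq by simp
qed

lemma (in double_star) xi2_sum:
  assumes G: "pverts G = V" "parcs G = R" and n: "card V = n"
  shows "\<xi> 2 G + \<xi> 2 (graph_complement G) = tree_bound n pq + complement_bound n pq"
  unfolding xi2_double_star[OF G n] tree_bound_def complement_bound_def ..

lemma star_complete_bipartite:
  assumes G: "pverts G = V" "parcs G = R" and "finite V" "b \<in> V"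
    and R: "R = {b} \<times> (V - {b}) \<union> (V - {b}) \<times> {b}"
  shows "K\<^bsub>1,card V - 1\<^esub> (with_proj G)"
proof -
  have "V = {b} \<union> (V - {b})" "card (V - {b}) = card V - 1" using assms by auto
  moreover have "{b} \<inter> (V - {b}) = {}" "card {b} = 1" by auto
  ultimately show ?thesis
    unfolding complete_bipartite_digraph_pair_def G using assms(3) R by blast
qed

theorem theorem4p6:
  fixes T :: "'a pair_pre_digraph" and n :: nat
  assumes tree: "undirected_tree T"
    and order: "card (pverts T) = n"
    and n: "n \<ge> 4"
    and not_star: "\<not> K\<^bsub>1,n - 1\<^esub> (with_proj T)"
  shows "(\<xi> 2 T + \<xi> 2 (graph_complement T) \<ge>
             sqrt ((13 * real n - 35 - sqrt (169 * (real n)\<^sup>2 - 974 * real n + 1417)) / 2)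
           + sqrt ((4 * real n + 1 - sqrt (16 * (real n)\<^sup>2 - 56 * real n + 193)) / 2))
    \<and> (\<xi> 2 T + \<xi> 2 (graph_complement T) =
             sqrt ((13 * real n - 35 - sqrt (169 * (real n)\<^sup>2 - 974 * real n + 1417)) / 2)
           + sqrt ((4 * real n + 1 - sqrt (16 * (real n)\<^sup>2 - 56 * real n + 193)) / 2)
           \<longleftrightarrow> digraph_iso (with_proj T) (with_proj (path_pendant_tree n)))"
proof -
  interpret tree_rel "pverts T" "parcs T" by (rule tree_rel_of_undirected_tree[OF tree])
  define \<sigma> where "\<sigma> = \<xi> 2 T + \<xi> 2 (graph_complement T)"
  define \<rho> where "\<rho> = tree_bound n (real n - 3) + complement_bound n (real n - 3)"
  have n': "real n \<ge> 4" using n by simp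
  have sum: "\<sigma> = tree_bound n (double_star.pq A B) + complement_bound n (double_star.pq A B)"
    if "double_star (pverts T) (parcs T) b c A B" for b c A B
    unfolding \<sigma>_def by (rule double_star.xi2_sum[OF that refl refl order])
  \<comment> \<open>An isomorphism with the extremal tree fixes the value of \<open>pq\<close>, and
    \<open>pq\<close> together with \<open>n\<close> determines both eigenvalues.\<close>
  have iso_eq: "\<sigma> = \<rho>" if iso: "digraph_iso (with_proj T) (with_proj (path_pendant_tree n))"
  proof -
    obtain b c A B where ds: "double_star (pverts T) (parcs T) b c A B" and A: "card A = 1"
      using double_star_of_iso[OF refl refl n iso] by blast
    have "double_star.pq A B = real n - 3"
      using double_star.pq_bound(2)[OF ds order] A by blast
    then show ?thesis unfolding sum[OF ds] \<rho>_def by simp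
  qed
  have "\<rho> \<le> \<sigma> \<and> (\<sigma> = \<rho> \<longrightarrow> digraph_iso (with_proj T) (with_proj (path_pendant_tree n)))"
  proof -
    have "4 \<le> card (pverts T)" using order n by simp
    then show ?thesis
    proof (cases rule: tree_shape)
      case (star b)
      then show ?thesis
        using star_complete_bipartite[OF refl refl finV] not_star order by blast
    next
      case (double_star b c A B)
      interpret ds: double_star "pverts T" "parcs T" b c A B by (rule double_star)
      show ?thesis
      proof (cases "ds.pq = real n - 3")
        case True
        \<comment> \<open>The second alternative becomes the first one when the two centres are
          exchanged.\<close>
        then consider "card A = 1" | "card B = 1" using ds.pq_bound(2)[OF order] by blast
        then have "digraph_iso (with_proj T) (with_proj (path_pendant_tree n))"
          using ds.iso_path_pendant_tree[OF refl refl order]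
            double_star.iso_path_pendant_tree[OF ds.swap refl refl order] by cases
        moreover have "\<sigma> = \<rho>" unfolding sum[OF double_star] \<rho>_def True ..
        ultimately show ?thesis by simp
      next
        case False
        then have "real n - 3 < ds.pq" using ds.pq_bound(1)[OF order] by simp
        \<comment> \<open>Both terms grow strictly beyond their values at \<open>n - 3\<close>, so
          equality is excluded as well.\<close>
        then have "\<rho> < \<sigma>"
          unfolding sum[OF double_star] \<rho>_def
          using tree_bound_less(2)[OF n'] complement_bound_less(2)[OF n'] by (intro add_strict_mono)
        then show ?thesis by simp
      qed
    next
      case (long a b c e)
      have "8 / 5 + 2 \<le> \<sigma>"
        unfolding \<sigma>_def by (rule add_mono; rule long_diameter_xi2_ge[OF refl refl long])
      \<comment> \<open>Strictness here rules out equality for all trees of diameter at least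
        4.\<close>
      moreover have "\<rho> < 8 / 5 + 2"
        unfolding \<rho>_def by (intro add_strict_mono tree_bound_less(1) complement_bound_less(1) n')
      ultimately show ?thesis by simp
    qed
  qed
  moreover have "\<rho> = sqrt ((13 * real n - 35 - sqrt (169 * (real n)\<^sup>2 - 974 * real n + 1417)) / 2)
           + sqrt ((4 * real n + 1 - sqrt (16 * (real n)\<^sup>2 - 56 * real n + 193)) / 2)"
  proof -
    have e1: "4 * real n - 8 + 9 * (real n - 3) = 13 * real n - 35" by simp
    have e2: "(13 * real n - 35)\<^sup>2 - 64 * (real n - 3) = 169 * (real n)\<^sup>2 - 974 * real n + 1417"
      by (simp add: power2_eq_square algebra_simps)
    have e3: "(4 * real n + 1)\<^sup>2 - 64 * (real n - 3) = 16 * (real n)\<^sup>2 - 56 * real n + 193"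
      by (simp add: power2_eq_square algebra_simps)
    show ?thesis unfolding \<rho>_def tree_bound_def complement_bound_def e1 e2 e3 by (rule refl)
  qed
  ultimately show ?thesis using iso_eq unfolding \<sigma>_def by auto
qed

end
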